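(* Let $t_0\in\mathbb{R}$ and let $c_0\in M_n$ be strictly positive (Hermitian with strictly positive eigenvalues). Then the noncommutative Ricci flow equation $\frac{d}{dt}c(t)=-\triangle\log c(t)$ with $c(t_0)=c_0$ has a unique solution $c$ on $[t_0,\infty)$ consisting of strictly positive matrices. Moreover $\tau(c(t))=\tau(c_0)$ for all $t\ge t_0$, and $\lim_{t\to\infty}c(t)=c_\infty 1$ (in any norm on $M_n$), where $c_\infty=\frac1n\tau(c_0)$. Finally, $\det c(t)$ is strictly increasing in $t$, unless $c_0=c_\infty 1$, in which case $c(t)=c_0$ for all $t$.
   Context: Let $n\ge 2$, let $m\in\{1,\dots,n-1\}$ be relatively prime to $n$, and set $q=e^{2\pi i m/n}$. Let $M_n$ be the algebra of complex $n\times n$ matrices with identity $1$. Let $u=\mathrm{diag}(1,q,\dots,q^{n-1})$ and let $v$ be the cyclic shift matrix with $v_{j,j+1}=1$ for $j=1,\dots,n-1$, $v_{n,1}=1$, other entries $0$. Let $x,y$ be any Hermitian matrices with $u=e^{\frac{2\pi i}{n}x}$ and $v=e^{\frac{2\pi i}{n}y}$. Define $\delta_1(a)=[y,a]$, $\delta_2(a)=-[x,a]$ and $\triangle=\delta_1^2+\delta_2^2$ on $M_n$. $\tau$ is the usual trace. For strictly positive $c$, $\log c$ is defined by functional calculus (diagonalize unitarily and take $\log$ of the eigenvalues). The time derivative is taken entrywise (equivalently in any norm). *)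

theory Defs
  imports "HOL-Analysis.Analysis" "Jordan_Normal_Form.Char_Poly" "Jordan_Normal_Form.Determinant"
begin

definition ctrans :: "complex mat \<Rightarrow> complex mat" where
  "ctrans A = mat (dim_col A) (dim_row A) (\<lambda>(i,j). cnj (A $$ (j,i)))"

definition hermitian_mat :: "nat \<Rightarrow> complex mat \<Rightarrow> bool" where
  "hermitian_mat n A \<longleftrightarrow> A \<in> carrier_mat n n \<and> ctrans A = A"

definition unitary_mat :: "nat \<Rightarrow> complex mat \<Rightarrow> bool" where
  "unitary_mat n U \<longleftrightarrow> U \<in> carrier_mat n n \<and> ctrans U * U = 1\<^sub>m n \<and> U * ctrans U = 1\<^sub>m n"

definition strictly_pos_mat :: "nat \<Rightarrow> complex mat \<Rightarrow> bool" where
  "strictly_pos_mat n A \<longleftrightarrow> hermitian_mat n A \<and>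
     (\<forall>k. eigenvalue A k \<longrightarrow> k \<in> \<real> \<and> Re k > 0)"

definition mtrace :: "complex mat \<Rightarrow> complex" where
  "mtrace A = (\<Sum>i<dim_row A. A $$ (i,i))"

definition herm_fun_calc :: "nat \<Rightarrow> (real \<Rightarrow> complex) \<Rightarrow> complex mat \<Rightarrow> complex mat" where
  "herm_fun_calc n f A = (SOME L. \<exists>U d. unitary_mat n U \<and>
      A = U * mat_diag n (\<lambda>i. complex_of_real (d i)) * ctrans U \<and>
      L = U * mat_diag n (\<lambda>i. f (d i)) * ctrans U)"

definition mat_log :: "nat \<Rightarrow> complex mat \<Rightarrow> complex mat" where
  "mat_log n c = herm_fun_calc n (\<lambda>s. complex_of_real (ln s)) c"

definition exp_2pii_over :: "nat \<Rightarrow> complex mat \<Rightarrow> complex mat" where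
  "exp_2pii_over n x = herm_fun_calc n (\<lambda>s. exp (2 * pi * \<i> * complex_of_real s / of_nat n)) x"

definition u_mat :: "nat \<Rightarrow> nat \<Rightarrow> complex mat" where
  "u_mat n m = mat_diag n (\<lambda>j. (exp (2 * pi * \<i> * of_nat m / of_nat n)) ^ j)"

text \<open>Cyclic shift: (1-indexed) v_{j,j+1} = 1, v_{n,1} = 1; 0-indexed: v(i,(i+1) mod n) = 1.\<close>
definition v_mat :: "nat \<Rightarrow> complex mat" where
  "v_mat n = mat n n (\<lambda>(i,j). if j = (i + 1) mod n then 1 else 0)"

definition nc_laplacian :: "complex mat \<Rightarrow> complex mat \<Rightarrow> complex mat \<Rightarrow> complex mat" where
  "nc_laplacian x y a =
     (let d1 = (\<lambda>b. y * b - b * y); d2 = (\<lambda>b. - (x * b - b * x)) in d1 (d1 a) + d2 (d2 a))"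

definition ricci_solution ::
  "nat \<Rightarrow> complex mat \<Rightarrow> complex mat \<Rightarrow> real \<Rightarrow> complex mat \<Rightarrow> (real \<Rightarrow> complex mat) \<Rightarrow> bool" where
  "ricci_solution n x y t0 c0 c \<longleftrightarrow>
     c t0 = c0 \<and>
     (\<forall>t\<ge>t0. strictly_pos_mat n (c t)) \<and>
     (\<forall>t\<ge>t0. \<forall>i<n. \<forall>j<n.
        ((\<lambda>s. c s $$ (i,j)) has_vector_derivative
           ((- nc_laplacian x y (mat_log n (c t))) $$ (i,j))) (at t within {t0..}))"

end

theory Submission
  imports Defs "Jordan_Normal_Form.Spectral_Radius"
begin

text \<open>
  Write \<open>hs\<close> for the real Hilbert--Schmidt inner product. In an eigenbasis of \<open>c\<close>, with
  eigenvalues \<open>d\<^sub>i\<close>, the pairing \<open>hs (f c) (\<triangle> (g c))\<close> is the sum of \<open>(f d\<^sub>j - f d\<^sub>i) (g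
  d\<^sub>j - g d\<^sub>i)\<close> with nonnegative weights. Hence along \<open>c' = - \<triangle> (f c)\<close> with \<open>f\<close> monotone,
  the trace of every convex function of \<open>c\<close> decreases. This gives a minimum principle for
  the spectrum, so the logarithm may be replaced by \<open>ln (max e s)\<close>, whose functional
  calculus is globally Lipschitz in the Hilbert--Schmidt norm: existence follows from a
  contraction argument on the half-line and uniqueness from Gronwall's inequality.

  The commutator with \<open>u = exp (2 \<pi> \<i> x / n)\<close> is dominated by the commutator with \<open>x\<close>, and
  likewise for \<open>v\<close> and \<open>y\<close>. As \<open>u\<close> controls the off-diagonal entries and \<open>v\<close> the
  differences of diagonal entries, \<open>\<triangle>\<close> has a spectral gap on trace zero matrices.
  Therefore the Hilbert--Schmidt distance of \<open>c\<close> to the scalar matrix of the same trace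
  decays exponentially. It decays at most exponentially, so a nonscalar solution never
  becomes scalar, and then the derivative of \<open>log (det c) = tr (log c)\<close> is strictly
  positive.
\<close>

subsection \<open>Adjoints and unitary matrices\<close>


text \<open>No eigenvalue or eigenvector of \<open>c t\<close> is differentiated, since eigenbases
  need not vary smoothly where eigenvalues cross. Only traces \<open>trf n g\<close> are, by
  comparison with a first-order expansion whose remainder is quadratic in the Hilbert--Schmidt
  distance. Thus \<open>g\<close> needs just a quadratic Taylor bound, and the square of a hinge
  function, which is not twice differentiable, can serve for the minimum principle.

  The logarithm has slopes that are unbounded near \<open>0\<close> and vanish at infinity, so both
  ends of the spectrum must be confined. The lower end is held by the minimum principle. The upper
  end comes from conservation of the trace: positive eigenvalues are bounded by their sum. In the
  uniqueness claim a competing solution is known to be positive at each time, without a uniform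
  lower bound; the minimum principle for \<open>ln\<close> on the open half-line supplies that bound
  before Gronwall is applied.

  The matrices \<open>x\<close> and \<open>y\<close> are arbitrary Hermitian logarithms, known
  through their exponentials \<open>u\<close> and \<open>v\<close>, which is why the gap is computed
  for \<open>u\<close> and \<open>v\<close>.\<close>

lemma mult_carrier_square[simp]:
  "A \<in> carrier_mat n n \<Longrightarrow> B \<in> carrier_mat n n \<Longrightarrow>
      A * B \<in> carrier_mat n n"
  by (rule mult_carrier_mat)

lemma mult_one_square[simp]:
  fixes A :: "'a :: semiring_1 mat"
  assumes "A \<in> carrier_mat n n"
  shows "A * 1\<^sub>m n = A" "1\<^sub>m n * A = A"
  using assms by simp_all

declare minus_carrier_mat[simp] uminus_carrier_mat[simp]

lemma index_mult_mat_sum: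
  assumes "A \<in> carrier_mat n m" "B \<in> carrier_mat m k" "i < n" "j < k"
  shows "(A * B) $$ (i,j) = (\<Sum>l<m. A $$ (i,l) * B $$ (l,j))"
  using assms by (auto simp: scalar_prod_def lessThan_atLeast0)

lemma ctrans_carrier[simp]: "A \<in> carrier_mat n m \<Longrightarrow> ctrans A \<in> carrier_mat m n"
  unfolding ctrans_def by auto

lemma ctrans_index[simp]: "A \<in> carrier_mat n m \<Longrightarrow> i < m \<Longrightarrow>
    j < n \<Longrightarrow> ctrans A $$ (i,j) = cnj (A $$ (j,i))"
  unfolding ctrans_def by auto

lemma dim_ctrans[simp]: "dim_row (ctrans A) = dim_col A" "dim_col (ctrans A) = dim_row A"
  by (simp_all add: ctrans_def)

lemma ctrans_ctrans[simp]: "ctrans (ctrans A) = A"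
  unfolding ctrans_def by auto

lemma ctrans_mult:
  assumes "A \<in> carrier_mat n m" "B \<in> carrier_mat m k"
  shows "ctrans (A * B) = ctrans B * ctrans A"
proof (rule eq_matI)
  fix i j assume "i < dim_row (ctrans B * ctrans A)" "j < dim_col (ctrans B * ctrans A)"
  then have i: "i < k" and j: "j < n" using assms by (auto simp: ctrans_def)
  have AB: "A * B \<in> carrier_mat n k" using assms by simp
  show "ctrans (A * B) $$ (i, j) = (ctrans B * ctrans A) $$ (i, j)"
    unfolding ctrans_index[OF AB i j] using i j assms
    by (simp del: index_mult_mat(1) add: index_mult_mat_sum[OF assms]
        index_mult_mat_sum[OF ctrans_carrier[OF assms(2)] ctrans_carrier[OF assms(1)]] mult.commute)
qed (use assms in \<open>auto simp: ctrans_def\<close>)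

lemma ctrans_minus:
  assumes "A \<in> carrier_mat n m" "B \<in> carrier_mat n m"
  shows "ctrans (A - B) = ctrans A - ctrans B"
  using assms by (auto simp: ctrans_def)

lemma ctrans_uminus: "ctrans (- A) = - ctrans A"
  by (auto simp: ctrans_def)

lemma ctrans_add:
  assumes "A \<in> carrier_mat n m" "B \<in> carrier_mat n m"
  shows "ctrans (A + B) = ctrans A + ctrans B"
  using assms by (auto simp: ctrans_def)

lemma ctrans_mat_diag: "ctrans (mat_diag n f) = mat_diag n (\<lambda>i. cnj (f i))"
  by (auto simp: ctrans_def mat_diag_def)

lemma ctrans_one[simp]: "ctrans (1\<^sub>m n) = 1\<^sub>m n"
  by (auto simp: ctrans_def)

lemma hermitian_carrier: "hermitian_mat n A \<Longrightarrow> A \<in> carrier_mat n n"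
  unfolding hermitian_mat_def by simp

lemma hermitian_ctrans: "hermitian_mat n A \<Longrightarrow> ctrans A = A"
  unfolding hermitian_mat_def by simp

lemma unitary_carrier: "unitary_mat n U \<Longrightarrow> U \<in> carrier_mat n n"
  unfolding unitary_mat_def by simp

lemma unitary_inv_mult:
  assumes "unitary_mat n U"
  shows "ctrans U * U = 1\<^sub>m n" "U * ctrans U = 1\<^sub>m n"
  using assms unfolding unitary_mat_def by auto

lemma unitary_cancel:
  assumes "unitary_mat n U" "X \<in> carrier_mat n k"
  shows "ctrans U * (U * X) = X" "U * (ctrans U * X) = X"
proof -
  note U = unitary_carrier[OF assms(1)]
  have "ctrans U * (U * X) = (ctrans U * U) * X"
    using U assms(2) assoc_mult_mat[of "ctrans U" n n U n X k] by simp
  then show "ctrans U * (U * X) = X" using unitary_inv_mult[OF assms(1)] assms(2) by simp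
  have "U * (ctrans U * X) = (U * ctrans U) * X"
    using U assms(2) assoc_mult_mat[of U n n "ctrans U" n X k] by simp
  then show "U * (ctrans U * X) = X" using unitary_inv_mult[OF assms(1)] assms(2) by simp
qed

lemma unitary_mult:
  assumes "unitary_mat n U" "unitary_mat n V"
  shows "unitary_mat n (U * V)"
proof -
  note [simp] = unitary_carrier[OF assms(1)] unitary_carrier[OF assms(2)]
    ctrans_mult[of U n n V n] unitary_inv_mult[OF assms(1)] unitary_inv_mult[OF assms(2)]
    unitary_cancel[OF assms(1), of _ n] unitary_cancel[OF assms(2), of _ n]
    assoc_mult_mat[of _ n n _ n _ n]
  show ?thesis unfolding unitary_mat_def by simp
qed

lemma unitary_one: "unitary_mat n (1\<^sub>m n)"
  unfolding unitary_mat_def by simp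

subsection \<open>The spectral theorem\<close>

text \<open>The Householder reflection along \<open>e\<^sub>0 - v\<close>; it maps \<open>e\<^sub>0\<close> to \<open>v\<close> because \<open>v 0\<close> is real.\<close>
lemma exists_unitary_first_col:
  fixes v :: "nat \<Rightarrow> complex"
  assumes n: "n > 0" and norm: "(\<Sum>i<n. (cmod (v i))\<^sup>2) = 1" and real: "v 0 = complex_of_real r"
  shows "\<exists>H. unitary_mat n H \<and> (\<forall>i<n. H $$ (i,0) = v i)"
\<comment> \<open>For \<open>r = 1\<close> the vector is \<open>e_0\<close> itself and there is no
  reflecting direction; the identity does.\<close>
proof (cases "r = 1")
  case True
  have "(\<Sum>i<n. (cmod (v i))\<^sup>2)
      = (cmod (v 0))\<^sup>2 + (\<Sum>i\<in>{..<n}-{0}. (cmod (v i))\<^sup>2)"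
    using n by (subst sum.remove[of _ 0]) auto
  then have "(\<Sum>i\<in>{..<n}-{0}. (cmod (v i))\<^sup>2) = 0" using norm real True by simp
  then have "\<forall>i\<in>{..<n}-{0}. v i = 0" by (subst (asm) sum_nonneg_eq_0_iff) auto
  then have "\<forall>i<n. 1\<^sub>m n $$ (i,0) = v i" using n real True by auto
  then show ?thesis using unitary_one by blast
next
  case False
  define w where "w i = (if i = 0 then 1 else 0) - v i" for i
  \<comment> \<open>The usual factor 2 / |w|^2 of a reflection, as |w|^2 = 2 - 2 r for a unit vector
    \<open>v\<close>.\<close>
  define c where "c = complex_of_real (1 / (1 - r))"
  define H where "H = mat n n (\<lambda>(i,j). (if i = j then 1 else 0) - c * w i * cnj (w j))"
  have H[simp]: "H \<in> carrier_mat n n" unfolding H_def by simp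
  have "(\<Sum>i<n. (cmod (w i))\<^sup>2) = (\<Sum>i<n. (if i
      = 0 then 1 - 2 * r else 0) + (cmod (v i))\<^sup>2)"
  proof (rule sum.cong[OF refl])
    fix i
    have "cmod (1 - complex_of_real r) = cmod (complex_of_real (1 - r))" by simp
    then have "cmod (1 - complex_of_real r) = \<bar>1 - r\<bar>" by (simp only: norm_of_real)
    then show "(cmod (w i))\<^sup>2 = (if i = 0 then 1 - 2 * r else 0) + (cmod (v i))\<^sup>2"
      unfolding w_def using real by (auto simp: power2_eq_square algebra_simps)
  qed
  also have "\<dots> = 2 - 2 * r" using n norm by (simp add: sum.distrib)
  finally have "complex_of_real (\<Sum>i<n. (cmod (w i))\<^sup>2) = 2 - 2 * complex_of_real r" by simp
  moreover have "complex_of_real (\<Sum>i<n. (cmod (w i))\<^sup>2) = (\<Sum>i<n. cnj (w i) * w i)"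
    unfolding of_real_sum by (intro sum.cong refl) (simp only: complex_norm_square mult.commute)
  ultimately have S: "(\<Sum>i<n. cnj (w i) * w i) = 2 - 2 * complex_of_real r" by simp
  have r1: "1 - complex_of_real r \<noteq> 0" using False
    by (metis eq_iff_diff_eq_0 of_real_1 of_real_eq_iff)
  have cS: "c * (\<Sum>i<n. cnj (w i) * w i) = 2"
    unfolding S c_def using r1 by (simp add: field_simps)
  have sym: "ctrans H = H"
    by (rule eq_matI) (auto simp: H_def ctrans_def c_def)
  have "H * H = 1\<^sub>m n"
  proof (rule eq_matI)
    fix i j assume "i < dim_row (1\<^sub>m n)" "j < dim_col (1\<^sub>m n)"
    then have i: "i < n" and j: "j < n" by auto
    have "(H * H) $$ (i,j) = (\<Sum>k<n. H $$ (i,k) * H $$ (k,j))"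
      using i j by (intro index_mult_mat_sum) auto
    also have "\<dots> = (\<Sum>k<n. (if i = k then (if k = j then 1 else 0) - c * w k * cnj (w j) else 0)
        - (if k = j then c * w i * cnj (w k) else 0)
        + c * w i * cnj (w j) * (c * (cnj (w k) * w k)))"
      using i j by (intro sum.cong refl) (auto simp: H_def algebra_simps)
    also have "\<dots> = ((if i = j then 1 else 0) - c * w i * cnj (w j)) - c * w i * cnj (w j)
        + c * w i * cnj (w j) * (c * (\<Sum>k<n. cnj (w k) * w k))"
      using i j by (simp add: sum.distrib sum_subtractf sum_distrib_left)
    also have "\<dots> = (if i = j then 1 else 0)" unfolding cS by simp
    finally show "(H * H) $$ (i,j) = 1\<^sub>m n $$ (i,j)" using i j by simp
  qed (auto simp: H_def)
  then have "unitary_mat n H" unfolding unitary_mat_def sym by simp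
  moreover have "H $$ (i,0) = v i" if "i < n" for i
  proof -
    have "c * cnj (w 0) = 1" using r1 real unfolding c_def w_def by (simp add: field_simps)
    then have cw: "c * w i * cnj (w 0) = w i" by (simp add: mult.assoc mult.left_commute)
    have "H $$ (i,0) = (if i = 0 then 1 else 0) - c * w i * cnj (w 0)"
      using that n unfolding H_def by simp
    then show ?thesis unfolding cw by (simp add: w_def)
  qed
  ultimately show ?thesis by blast
qed

text \<open>The direct sum of a scalar and a matrix; it glues a split-off eigenvalue to the
  diagonalized remaining block.\<close>

definition ext_mat :: "nat \<Rightarrow> complex \<Rightarrow> complex mat \<Rightarrow> complex mat" where
  "ext_mat n a M = mat (Suc n) (Suc n)
     (\<lambda>(i,j). if i = 0 \<and> j = 0 then a else if i = 0 \<or> j = 0 then 0 else M $$ (i - 1, j - 1))"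

lemma ext_mat_carrier[simp]: "ext_mat n a M \<in> carrier_mat (Suc n) (Suc n)"
  unfolding ext_mat_def by simp

lemma ext_mat_mult:
  assumes "M \<in> carrier_mat n n" "N \<in> carrier_mat n n"
  shows "ext_mat n a M * ext_mat n b N = ext_mat n (a * b) (M * N)"
proof (rule eq_matI)
  fix i j assume "i < dim_row (ext_mat n (a * b) (M * N))" "j < dim_col (ext_mat n (a * b) (M * N))"
  then have i: "i < Suc n" and j: "j < Suc n" by (auto simp: ext_mat_def)
  have "(ext_mat n a M * ext_mat n b N) $$ (i,j)
      = (\<Sum>l<Suc n. ext_mat n a M $$ (i,l) * ext_mat n b N $$ (l,j))"
    using i j by (intro index_mult_mat_sum) auto
  also have "\<dots> = ext_mat n a M $$ (i,0) * ext_mat n b N $$ (0,j)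
      + (\<Sum>l<n. ext_mat n a M $$ (i,Suc l) * ext_mat n b N $$ (Suc l,j))"
    by (rule sum.lessThan_Suc_shift)
  also have "\<dots> = ext_mat n (a * b) (M * N) $$ (i,j)"
  proof (cases "i = 0 \<or> j = 0")
    case True
    then show ?thesis using i j by (auto simp: ext_mat_def)
  next
    case False
    then have "(M * N) $$ (i - 1, j - 1) = (\<Sum>l<n. M $$ (i - 1,l) * N $$ (l,j - 1))"
      using assms i j by (intro index_mult_mat_sum) auto
    then show ?thesis using False i j by (simp add: ext_mat_def)
  qed
  finally show "(ext_mat n a M * ext_mat n b N) $$ (i,j) = ext_mat n (a * b) (M * N) $$ (i,j)" .
qed (auto simp: ext_mat_def)

lemma ctrans_ext_mat:
  assumes "M \<in> carrier_mat n n"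
  shows "ctrans (ext_mat n a M) = ext_mat n (cnj a) (ctrans M)"
  using assms by (auto simp: ext_mat_def ctrans_def)

lemma ext_mat_one: "ext_mat n 1 (1\<^sub>m n) = 1\<^sub>m (Suc n)"
  by (rule eq_matI) (auto simp: ext_mat_def)

lemma ext_mat_diag: "ext_mat n a (mat_diag n f) = mat_diag (Suc n) (case_nat a f)"
  by (rule eq_matI) (auto simp: ext_mat_def mat_diag_def split: nat.split)

lemma unit_eigenvector_exists:
  assumes A: "A \<in> carrier_mat n n" and n: "n > 0"
  shows "\<exists>v k r. v \<in> carrier_vec n \<and> A *\<^sub>v v
      = k \<cdot>\<^sub>v v \<and> (\<Sum>i<n. (cmod (v $ i))\<^sup>2) = 1
    \<and> v $ 0 = complex_of_real r"
proof -
  obtain k where "eigenvalue A k" using spectrum_non_empty[OF A] n unfolding spectrum_def by auto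
  then obtain w where w: "w \<in> carrier_vec n" "w \<noteq> 0\<^sub>v n" "A *\<^sub>v w = k \<cdot>\<^sub>v w"
    using A unfolding eigenvalue_def eigenvector_def by auto
  define S where "S = (\<Sum>i<n. (cmod (w $ i))\<^sup>2)"
  have "S \<noteq> 0"
  proof
    assume "S = 0"
    then have "\<forall>i<n. w $ i = 0" unfolding S_def by (subst (asm) sum_nonneg_eq_0_iff) auto
    then have "w = 0\<^sub>v n" using w(1) by (intro eq_vecI) auto
    then show False using w by simp
  qed
  then have S: "S > 0" unfolding S_def by (metis sum_nonneg zero_le_power2 order_le_less)
  \<comment> \<open>A phase that rotates the first coordinate onto the nonnegative reals, as the
    Householder reflection requires.\<close>
  define p where "p = (if w $ 0 = 0 then 1 else cnj (w $ 0) / complex_of_real (cmod (w $ 0)))"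
  have p: "cmod p = 1" unfolding p_def by (auto simp: norm_divide)
  define a where "a = p / complex_of_real (sqrt S)"
  have ca: "(cmod a)\<^sup>2 = 1 / S" using p S unfolding a_def by (simp add: norm_divide power_divide)
  have "(a \<cdot>\<^sub>v w) \<in> carrier_vec n" using w by simp
  moreover have "A *\<^sub>v (a \<cdot>\<^sub>v w) = k \<cdot>\<^sub>v (a \<cdot>\<^sub>v w)"
    using w A by (simp add: mult_mat_vec[OF A] smult_smult_assoc mult.commute)
  moreover have "(\<Sum>i<n. (cmod ((a \<cdot>\<^sub>v w) $ i))\<^sup>2) = 1"
  proof -
    have "(\<Sum>i<n. (cmod ((a \<cdot>\<^sub>v w) $ i))\<^sup>2)
        = (\<Sum>i<n. (cmod a)\<^sup>2 * (cmod (w $ i))\<^sup>2)"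
      using w by (intro sum.cong) (auto simp: norm_mult power_mult_distrib)
    also have "\<dots> = (cmod a)\<^sup>2 * S" by (simp add: S_def sum_distrib_left)
    finally show ?thesis using ca S by simp
  qed
  moreover have "(a \<cdot>\<^sub>v w) $ 0 = complex_of_real (cmod (w $ 0) / sqrt S)"
  proof (cases "w $ 0 = 0")
    case True then show ?thesis using w n by simp
  next
    case False
    have "cnj (w $ 0) * w $ 0 = complex_of_real (cmod (w $ 0)) * complex_of_real (cmod (w $ 0))"
      using complex_norm_square[of "w $ 0"] by (simp add: power2_eq_square mult.commute)
    then have "p * w $ 0 = complex_of_real (cmod (w $ 0))"
      using False unfolding p_def by simp
    then show ?thesis using w n unfolding a_def by simp
  qed
  ultimately show ?thesis by blast
qed

text \<open>Deflation: conjugating by a unitary whose first column is an eigenvector clears the rest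
  of the first column, hence by symmetry of the first row, and leaves a smaller Hermitian block for
  the induction.\<close>

theorem hermitian_spectral:
  assumes "hermitian_mat n A"
  shows "\<exists>U d. unitary_mat n U \<and> A = U * mat_diag n (\<lambda>i. complex_of_real (d i)) * ctrans U"
  using assms
proof (induction n arbitrary: A)
  case 0
  have "dim_row A = 0" "dim_col A = 0" using hermitian_carrier[OF 0] by auto
  then have "A = 1\<^sub>m 0 * mat_diag 0 (\<lambda>i. complex_of_real (0::real)) * ctrans (1\<^sub>m 0)"
    by - (rule eq_matI; simp add: mat_diag_def ctrans_def)
  with unitary_one show ?case by (intro exI[of _ "1\<^sub>m 0"] exI[of _ "\<lambda>_. 0"] conjI)
next
  case (Suc n)
  let ?n = "Suc n"
  note A = hermitian_carrier[OF Suc.prems]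
  obtain v :: "complex Matrix.vec"
      and k r where v: "v \<in> carrier_vec ?n" "A *\<^sub>v v = k \<cdot>\<^sub>v v"
      "(\<Sum>i<?n. (cmod (v $ i))\<^sup>2) = 1" "v $ 0 = complex_of_real r"
    using unit_eigenvector_exists[OF A] by auto
  obtain H where H: "unitary_mat ?n H" and H0: "\<And>i. i < ?n \<Longrightarrow> H $$ (i,0) = v $ i"
    using exists_unitary_first_col[of ?n "\<lambda>i. v $ i"] v by auto
  note [simp] = A unitary_carrier[OF H] unitary_inv_mult[OF H] unitary_cancel[OF H, of _ ?n]
    assoc_mult_mat[of _ ?n ?n _ ?n _ ?n]
  define B where "B = ctrans H * A * H"
  have B[simp]: "B \<in> carrier_mat ?n ?n" unfolding B_def by simp
  have Bsym: "ctrans B = B"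
    unfolding B_def using hermitian_ctrans[OF Suc.prems]
    by (simp add: ctrans_mult[of _ ?n ?n _ ?n])
  have AHB: "A * H = H * B" unfolding B_def by simp
  have B0: "B $$ (i,0) = (if i = 0 then k else 0)" if i: "i < ?n" for i
  proof -
    have "col (A * H) 0 = A *\<^sub>v v"
    proof -
      have "col H 0 = v" using v(1) H0 carrier_matD[OF unitary_carrier[OF H]] by (intro eq_vecI) auto
      then show ?thesis using col_mult2[of A ?n ?n H ?n 0] by simp
    qed
    then have AH0: "(A * H) $$ (l,0) = k * H $$ (l,0)" if "l < ?n" for l
    proof -
      have "(A * H) $$ (l,0) = col (A * H) 0 $ l"
          using that carrier_matD[OF A] carrier_matD[OF unitary_carrier[OF H]] by simp
      also have "\<dots> = (k \<cdot>\<^sub>v v) $ l"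
          unfolding \<open>col (A * H) 0 = A *\<^sub>v v\<close> v(2) ..
      also have "\<dots> = k * v $ l" using that v(1) by simp
      finally show ?thesis using H0[OF that] by simp
    qed
    have "B $$ (i,0) = (ctrans H * (A * H)) $$ (i,0)" unfolding B_def by simp
    also have "\<dots> = (\<Sum>l<?n. ctrans H $$ (i,l) * (A * H) $$ (l,0))"
      using i by (intro index_mult_mat_sum[of _ ?n ?n _ ?n]) auto
    also have "\<dots> = (\<Sum>l<?n. k * (ctrans H $$ (i,l) * H $$ (l,0)))"
      by (intro sum.cong refl) (auto simp: AH0 simp del: index_mult_mat)
    also have "\<dots> = k * (ctrans H * H) $$ (i,0)"
      using i by (subst index_mult_mat_sum[of "ctrans H" ?n ?n H ?n])
        (auto simp: sum_distrib_left simp del: sum.lessThan_Suc)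
    also have "\<dots> = (if i = 0 then k else 0)" using i by simp
    finally show ?thesis .
  qed
  have Bc: "B $$ (i,j) = cnj (B $$ (j,i))" if "i < ?n" "j < ?n" for i j
    using Bsym ctrans_index[OF B that] by simp
  define A' where "A' = mat n n (\<lambda>(i,j). B $$ (Suc i, Suc j))"
  have A'[simp]: "A' \<in> carrier_mat n n" unfolding A'_def by simp
  have "hermitian_mat n A'"
    unfolding hermitian_mat_def
  proof (intro conjI A' eq_matI)
    fix i j assume "i < dim_row A'" "j < dim_col A'"
    then have ij: "i < n" "j < n" by (auto simp: A'_def)
    then have "ctrans A' $$ (i,j) = cnj (B $$ (Suc j, Suc i))"
      unfolding ctrans_index[OF A' ij] by (simp add: A'_def)
    also have "\<dots> = A' $$ (i,j)" using Bc[of "Suc i" "Suc j"] ij by (simp add: A'_def)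
    finally show "ctrans A' $$ (i,j) = A' $$ (i,j)" .
  qed (auto simp: A'_def ctrans_def)
  then obtain U d where U: "unitary_mat n U"
      and Ud: "A' = U * mat_diag n (\<lambda>i. complex_of_real (d i)) * ctrans U"
    using Suc.IH by blast
  have kreal: "k = complex_of_real (Re k)"
  proof -
    have "k = cnj k" using Bc[of 0 0] B0[of 0] by (metis zero_less_Suc)
    then show ?thesis by (simp add: complex_eq_iff)
  qed
  have BA': "B = ext_mat n k A'"
  proof (rule eq_matI)
    fix i j assume "i < dim_row (ext_mat n k A')" "j < dim_col (ext_mat n k A')"
    then have ij: "i < ?n" "j < ?n" by (auto simp: ext_mat_def)
    show "B $$ (i,j) = ext_mat n k A' $$ (i,j)"
    proof (cases "j = 0")
      case True
      then show ?thesis using ij B0[OF ij(1)] by (simp add: ext_mat_def)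
    next
      case False
      then have "i = 0 \<Longrightarrow> B $$ (i,j) = 0" using Bc[OF ij] B0[OF ij(2)]
          by (metis complex_cnj_zero)
      then show ?thesis using ij False by (cases i; cases j) (auto simp: ext_mat_def A'_def)
    qed
  qed (simp_all add: ext_mat_def carrier_matD[OF B])
  define G where "G = ext_mat n 1 U"
  define e where "e = case_nat (Re k) d"
  note U' = unitary_carrier[OF U]
  have G: "unitary_mat ?n G" unfolding unitary_mat_def G_def
    using U' unitary_inv_mult[OF U] by (simp add: ctrans_ext_mat ext_mat_mult ext_mat_one)
  have de: "mat_diag ?n (\<lambda>i. complex_of_real (e i))
      = ext_mat n k (mat_diag n (\<lambda>i. complex_of_real (d i)))"
    unfolding ext_mat_diag e_def using kreal by (intro arg_cong[of _ _ "mat_diag ?n"]) (auto split: nat.split)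
  have "G * mat_diag ?n (\<lambda>i. complex_of_real (e i)) * ctrans G = B"
    unfolding de G_def BA' Ud using U' by (simp add: ctrans_ext_mat ext_mat_mult)
  note GB = this
  have "A = H * B * ctrans H" unfolding B_def by (simp add: assoc_mult_mat[of _ ?n ?n _ ?n _ ?n])
  also have "\<dots> = (H * G) * mat_diag ?n (\<lambda>i. complex_of_real (e i)) * ctrans (H * G)"
    unfolding GB[symmetric] using unitary_carrier[OF G] by (simp add: ctrans_mult[of H ?n ?n G ?n])
  finally show ?case using unitary_mult[OF H G] by blast
qed


subsection \<open>Hilbert--Schmidt inner product\<close>

text \<open>The real part makes the form symmetric on all matrices. On Hermitian ones nothing is
  lost, since the trace of a product of two of them is real.\<close>

definition hs :: "complex mat \<Rightarrow> complex mat \<Rightarrow> real" where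
  "hs A B = Re (mtrace (ctrans A * B))"

lemma hs_sum:
  assumes A: "A \<in> carrier_mat n n" and B: "B \<in> carrier_mat n n"
  shows "hs A B = (\<Sum>i<n. \<Sum>j<n. Re (cnj (A $$ (i,j)) * B $$ (i,j)))"
proof -
  have "mtrace (ctrans A * B) = (\<Sum>i<n. \<Sum>k<n. cnj (A $$ (k,i)) * B $$ (k,i))"
    unfolding mtrace_def using A B
    by (auto intro!: sum.cong simp del: index_mult_mat(1) simp: index_mult_mat_sum[of "ctrans A" n n B n])
  also have "\<dots> = (\<Sum>i<n. \<Sum>j<n. cnj (A $$ (i,j)) * B $$ (i,j))"
    by (rule sum.swap)
  finally show ?thesis unfolding hs_def by simp
qed

lemma hs_self_sum:
  assumes A: "A \<in> carrier_mat n n"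
  shows "hs A A = (\<Sum>i<n. \<Sum>j<n. (cmod (A $$ (i,j)))\<^sup>2)"
  unfolding hs_sum[OF A A] by (intro sum.cong refl) (metis Re_complex_of_real complex_norm_square mult.commute)

lemma hs_self_nonneg: "A \<in> carrier_mat n n \<Longrightarrow> 0 \<le> hs A A"
  by (simp add: hs_self_sum sum_nonneg)

lemma entry_le_hs:
  assumes A: "A \<in> carrier_mat n n" and ij: "i < n" "j < n"
  shows "(cmod (A $$ (i,j)))\<^sup>2 \<le> hs A A"
proof -
  have "(cmod (A $$ (i,j)))\<^sup>2 \<le> (\<Sum>j<n. (cmod (A $$ (i,j)))\<^sup>2)"
    using ij by (intro member_le_sum) auto
  also have "\<dots> \<le> (\<Sum>i<n. \<Sum>j<n. (cmod (A $$ (i,j)))\<^sup>2)"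
    using ij by (intro member_le_sum[of i "{..<n}" "\<lambda>i. \<Sum>j<n. (cmod (A $$
        (i,j)))\<^sup>2"]) (auto intro: sum_nonneg)
  finally show ?thesis using hs_self_sum[OF A] by simp
qed

lemma hs_self_eq_0:
  assumes A: "A \<in> carrier_mat n n" and "hs A A \<le> 0"
  shows "A = 0\<^sub>m n n"
proof (rule eq_matI)
  fix i j assume "i < dim_row (0\<^sub>m n n)" "j < dim_col (0\<^sub>m n n)"
  then have ij: "i < n" "j < n" by auto
  have "(cmod (A $$ (i,j)))\<^sup>2 \<le> 0" using entry_le_hs[OF A ij] assms(2) by linarith
  then show "A $$ (i,j) = 0\<^sub>m n n $$ (i,j)" using ij by simp
qed (use A in auto)

lemma hs_sym:
  assumes A: "A \<in> carrier_mat n n" and B: "B \<in> carrier_mat n n"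
  shows "hs A B = hs B A"
  unfolding hs_sum[OF A B] hs_sum[OF B A] by (intro sum.cong refl) (simp add: mult.commute)

lemma hs_add_right:
  assumes "A \<in> carrier_mat n n" "B \<in> carrier_mat n n" "C \<in> carrier_mat n n"
  shows "hs A (B + C) = hs A B + hs A C"
  using assms by (simp add: hs_sum[of _ n] sum.distrib distrib_left)

lemma hs_minus_right:
  assumes "A \<in> carrier_mat n n" "B \<in> carrier_mat n n" "C \<in> carrier_mat n n"
  shows "hs A (B - C) = hs A B - hs A C"
  using assms by (simp add: hs_sum[of _ n] sum_subtractf sum.distrib left_diff_distrib right_diff_distrib)

lemma hs_minus_left:
  assumes "A \<in> carrier_mat n n" "B \<in> carrier_mat n n" "C \<in> carrier_mat n n"
  shows "hs (A - B) C = hs A C - hs B C"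
  using assms by (simp add: hs_sum[of _ n] sum_subtractf sum.distrib left_diff_distrib right_diff_distrib)

lemma hs_uminus_right:
  assumes "A \<in> carrier_mat n n" "B \<in> carrier_mat n n"
  shows "hs A (- B) = - hs A B"
  using assms by (simp add: hs_sum[of _ n] sum_negf sum.distrib sum_subtractf)

lemma hs_uminus_self:
  assumes "A \<in> carrier_mat n n"
  shows "hs (- A) (- A) = hs A A"
  using assms by (simp add: hs_sum[of _ n])

lemma mtrace_mult_commute:
  assumes "A \<in> carrier_mat n n" "B \<in> carrier_mat n n"
  shows "mtrace (A * B) = mtrace (B * A)"
proof -
  have "mtrace (A * B) = (\<Sum>i<n. \<Sum>k<n. A $$ (i,k) * B $$ (k,i))"
    unfolding mtrace_def using assms
    by (auto intro!: sum.cong simp del: index_mult_mat(1) simp: index_mult_mat_sum[of A n n B n])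
  also have "\<dots> = (\<Sum>k<n. \<Sum>i<n. B $$ (k,i) * A $$ (i,k))"
    by (subst sum.swap) (simp add: mult.commute)
  also have "\<dots> = mtrace (B * A)"
    unfolding mtrace_def using assms
    by (auto intro!: sum.cong simp del: index_mult_mat(1) simp: index_mult_mat_sum[of B n n A n])
  finally show ?thesis .
qed

lemma mtrace_minus:
  assumes "A \<in> carrier_mat n n" "B \<in> carrier_mat n n"
  shows "mtrace (A - B) = mtrace A - mtrace B"
  using assms by (auto simp: mtrace_def sum_subtractf)

lemma mtrace_add:
  assumes "A \<in> carrier_mat n n" "B \<in> carrier_mat n n"
  shows "mtrace (A + B) = mtrace A + mtrace B"
  using assms by (auto simp: mtrace_def sum.distrib)

text \<open>Two different unitaries are allowed so that a pair of matrices can be read in an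
  eigenbasis of one on the left and of the other on the right.\<close>

lemma hs_unitary:
  assumes U: "unitary_mat n U" and V: "unitary_mat n V"
    and A[simp]: "A \<in> carrier_mat n n" and B[simp]: "B \<in> carrier_mat n n"
  shows "hs (ctrans U * A * V) (ctrans U * B * V) = hs A B"
proof -
  note [simp] = unitary_carrier[OF U] unitary_carrier[OF V] ctrans_mult[of _ n n _ n]
    unitary_inv_mult[OF U] unitary_inv_mult[OF V]
    unitary_cancel[OF U, of _ n] unitary_cancel[OF V, of _ n] assoc_mult_mat[of _ n n _ n _ n]
  have "mtrace (ctrans V * ((ctrans A * B) * V)) = mtrace (((ctrans A * B) * V) * ctrans V)"
    by (rule mtrace_mult_commute[of _ n]) auto
  then show ?thesis unfolding hs_def by simp
qed

lemma hs_mult_self_le: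
  assumes A: "A \<in> carrier_mat n n" and B: "B \<in> carrier_mat n n"
  shows "hs (A * B) (A * B) \<le> hs A A * hs B B"
proof -
  have AB: "A * B \<in> carrier_mat n n" using A B by simp
  have "(cmod ((A * B) $$ (i,j)))\<^sup>2
      \<le> (\<Sum>k<n. (cmod (A $$ (i,k)))\<^sup>2) * (\<Sum>k<n. (cmod (B $$ (k,j)))\<^sup>2)"
    if "i < n" "j < n" for i j
  proof -
    have "cmod ((A * B) $$ (i,j)) \<le> (\<Sum>k<n. cmod (A $$ (i,k)) * cmod (B $$ (k,j)))"
      unfolding index_mult_mat_sum[OF A B that] by (rule order_trans[OF norm_sum]) (simp add: norm_mult)
    then have "(cmod ((A * B) $$ (i,j)))\<^sup>2
        \<le> (\<Sum>k<n. cmod (A $$ (i,k)) * cmod (B $$ (k,j)))\<^sup>2"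
      by (rule power_mono) simp
    also have "\<dots> \<le> (\<Sum>k<n. (cmod (A $$ (i,k)))\<^sup>2) * (\<Sum>k<n. (cmod (B $$
        (k,j)))\<^sup>2)"
      by (rule Cauchy_Schwarz_ineq_sum)
    finally show ?thesis .
  qed
  then have "hs (A * B) (A * B)
      \<le> (\<Sum>i<n. \<Sum>j<n. (\<Sum>k<n. (cmod (A $$ (i,k)))\<^sup>2) * (\<Sum>k<n. (cmod (B
          $$ (k,j)))\<^sup>2))"
    unfolding hs_self_sum[OF AB] by (intro sum_mono) auto
  also have "\<dots> = (\<Sum>i<n. \<Sum>k<n. (cmod (A $$ (i,k)))\<^sup>2) * (\<Sum>j<n. \<Sum>k<n.
      (cmod (B $$ (k,j)))\<^sup>2)"
    by (simp add: sum_product)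
  also have "(\<Sum>j<n. \<Sum>k<n. (cmod (B $$ (k,j)))\<^sup>2)
      = (\<Sum>k<n. \<Sum>j<n. (cmod (B $$ (k,j)))\<^sup>2)"
    by (rule sum.swap)
  finally show ?thesis using hs_self_sum[OF A] hs_self_sum[OF B] by simp
qed

lemma hs_add_self_le:
  assumes A: "A \<in> carrier_mat n n" and B: "B \<in> carrier_mat n n"
  shows "hs (A + B) (A + B) \<le> 2 * hs A A + 2 * hs B B"
proof -
  have AB: "A + B \<in> carrier_mat n n" using A B by simp
  have *: "(cmod (a + b))\<^sup>2 \<le> 2 * (cmod a)\<^sup>2 + 2 * (cmod b)\<^sup>2" for a b :: complex
  proof -
    have "(cmod (a + b))\<^sup>2 \<le> (cmod a + cmod b)\<^sup>2" by (intro power_mono norm_triangle_ineq) simp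
    also have "\<dots> \<le> 2 * (cmod a)\<^sup>2 + 2 * (cmod b)\<^sup>2"
      using zero_le_power2[of "cmod a - cmod b"] by (simp add: power2_eq_square algebra_simps)
    finally show ?thesis .
  qed
  have "hs (A + B) (A + B) \<le> (\<Sum>i<n. \<Sum>j<n. 2 * (cmod (A $$ (i,j)))\<^sup>2
      + 2 * (cmod (B $$ (i,j)))\<^sup>2)"
    unfolding hs_self_sum[OF AB] using A B * by (intro sum_mono) auto
  also have "\<dots> = 2 * hs A A + 2 * hs B B"
    unfolding hs_self_sum[OF A] hs_self_sum[OF B] by (simp add: sum.distrib sum_distrib_left)
  finally show ?thesis .
qed

lemma hs_minus_self_le:
  assumes A: "A \<in> carrier_mat n n" and B: "B \<in> carrier_mat n n"
  shows "hs (A - B) (A - B) \<le> 2 * hs A A + 2 * hs B B"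
  using hs_add_self_le[OF A, of "- B"] hs_uminus_self[OF B] A B minus_add_uminus_mat[OF A B] by simp

lemma hs_Young:
  assumes A: "A \<in> carrier_mat n n" and B: "B \<in> carrier_mat n n"
  shows "2 * \<bar>hs A B\<bar> \<le> hs A A + hs B B"
proof -
  have AB: "A - B \<in> carrier_mat n n" "A + B \<in> carrier_mat n n" using A B by auto
  have "0 \<le> hs (A - B) (A - B)" by (rule hs_self_nonneg[OF AB(1)])
  also have "\<dots> = hs A A + hs B B - 2 * hs A B"
    using A B by (simp add: hs_minus_left[of _ n] hs_minus_right[of _ n] hs_sym[of B n A])
  finally have 1: "2 * hs A B \<le> hs A A + hs B B" by simp
  have "0 \<le> hs (A - (- B)) (A - (- B))" using A B by (intro hs_self_nonneg[of _ n]) auto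
  also have "\<dots> = hs A A + hs B B + 2 * hs A B"
    using A B by (simp add: hs_minus_left[of _ n] hs_minus_right[of _ n] hs_uminus_right[of _ n]
       hs_sym[of "-B" n A] hs_sym[of "-B" n B] hs_uminus_self[of B n])
  finally show ?thesis using 1 by linarith
qed

subsection \<open>Functional calculus\<close>

abbreviation diagr :: "nat \<Rightarrow> (nat \<Rightarrow> real) \<Rightarrow> complex mat" where
  "diagr n d \<equiv> mat_diag n (\<lambda>i. complex_of_real (d i))"

definition has_spectral :: "nat \<Rightarrow> complex mat \<Rightarrow> complex mat \<Rightarrow>
    (nat \<Rightarrow> real) \<Rightarrow> bool" where
  "has_spectral n A U d \<longleftrightarrow> unitary_mat n U \<and> A = U * diagr n d * ctrans U"

lemma has_spectral_carrier: "has_spectral n A U d \<Longrightarrow> A \<in> carrier_mat n n"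
  unfolding has_spectral_def using unitary_carrier
  by (metis ctrans_carrier mat_diag_dim mult_carrier_mat)

text \<open>Conjugating from both sides by possibly different eigenbases makes functions of the two
  matrices act on the entries of the transition matrix \<open>ctrans U * V\<close>; all perturbation
  estimates for the functional calculus become scalar estimates for these entries.\<close>
lemma two_basis:
  assumes U: "unitary_mat n U" and V: "unitary_mat n V" and i: "i < n" and j: "j < n"
  shows "(ctrans U * (U * mat_diag n f * ctrans U) * V) $$ (i,j) = f i * (ctrans U * V) $$ (i,j)"
    and "(ctrans U * (V * mat_diag n g * ctrans V) * V) $$ (i,j) = (ctrans U * V) $$ (i,j) * g j"
proof -
  note [simp] = unitary_carrier[OF U] unitary_carrier[OF V]
    unitary_inv_mult[OF U] unitary_inv_mult[OF V]
    unitary_cancel[OF U, of _ n] unitary_cancel[OF V, of _ n] assoc_mult_mat[of _ n n _ n _ n]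
  have W: "ctrans U * V \<in> carrier_mat n n" by simp
  have 1: "ctrans U * (U * mat_diag n f * ctrans U) * V = mat_diag n f * (ctrans U * V)" by simp
  show "(ctrans U * (U * mat_diag n f * ctrans U) * V) $$ (i,j) = f i * (ctrans U * V) $$ (i,j)"
    unfolding 1 using i j by (subst mat_diag_mult_left[OF W]) simp
  have 2: "ctrans U * (V * mat_diag n g * ctrans V) * V = (ctrans U * V) * mat_diag n g" by simp
  show "(ctrans U * (V * mat_diag n g * ctrans V) * V) $$ (i,j) = (ctrans U * V) $$ (i,j) * g j"
    unfolding 2 using i j by (subst mat_diag_mult_right[OF W]) simp
qed

lemma unitary_conj_eqD:
  assumes U: "unitary_mat n U" and V: "unitary_mat n V"
    and A: "A \<in> carrier_mat n n" and B: "B \<in> carrier_mat n n"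
    and eq: "\<And>i j. i < n \<Longrightarrow> j < n \<Longrightarrow>
        (ctrans U * A * V) $$ (i,j) = (ctrans U * B * V) $$ (i,j)"
  shows "A = B"
proof -
  note [simp] = unitary_carrier[OF U] unitary_carrier[OF V] A B
    unitary_inv_mult[OF U] unitary_inv_mult[OF V]
    unitary_cancel[OF U, of _ n] unitary_cancel[OF V, of _ n] assoc_mult_mat[of _ n n _ n _ n]
  have "ctrans U * A * V = ctrans U * B * V"
  proof (rule eq_matI)
    show "dim_row (ctrans U * A * V) = dim_row (ctrans U * B * V)"
      "dim_col (ctrans U * A * V) = dim_col (ctrans U * B * V)" by auto
    have "dim_row (ctrans U * B * V) = n" "dim_col (ctrans U * B * V) = n"
      using carrier_matD[OF unitary_carrier[OF U]] carrier_matD[OF unitary_carrier[OF V]] by auto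
    then show "\<And>i j. i < dim_row (ctrans U * B * V) \<Longrightarrow>
        j < dim_col (ctrans U * B * V) \<Longrightarrow>
       (ctrans U * A * V) $$ (i,j) = (ctrans U * B * V) $$ (i,j)" using eq by metis
  qed
  then have "U * (ctrans U * A * V) * ctrans V = U * (ctrans U * B * V) * ctrans V" by simp
  then show ?thesis by simp
qed

text \<open>Independence of the diagonalization picked by \<open>SOME\<close>: an entry of the
  transition matrix between two eigenbases of \<open>A\<close> can be nonzero only where the two
  eigenvalues agree, and there \<open>f\<close> takes the same value.\<close>

lemma herm_fun_calc_eq:
  assumes "has_spectral n A U d"
  shows "herm_fun_calc n f A = U * mat_diag n (\<lambda>i. f (d i)) * ctrans U"
  unfolding herm_fun_calc_def
proof (rule some_equality)
  show "\<exists>U' d'. unitary_mat n U' \<and> A = U' * diagr n d' * ctrans U' \<and>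
      U * mat_diag n (\<lambda>i. f (d i)) * ctrans U = U' * mat_diag n (\<lambda>i. f (d' i)) * ctrans U'"
    using assms unfolding has_spectral_def by blast
next
  fix L assume "\<exists>U' d'. unitary_mat n U' \<and> A = U' * diagr n d' * ctrans U' \<and>
      L = U' * mat_diag n (\<lambda>i. f (d' i)) * ctrans U'"
  then obtain V e where V: "unitary_mat n V" and Ae: "A = V * diagr n e * ctrans V"
    and L: "L = V * mat_diag n (\<lambda>i. f (e i)) * ctrans V" by blast
  from assms have U: "unitary_mat n U" and Ad: "A = U * diagr n d * ctrans U"
    unfolding has_spectral_def by auto
  note [simp] = unitary_carrier[OF U] unitary_carrier[OF V]
  show "L = U * mat_diag n (\<lambda>i. f (d i)) * ctrans U"
  proof (rule unitary_conj_eqD[OF U V])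
    show "L \<in> carrier_mat n n" "U * mat_diag n (\<lambda>i. f (d i)) * ctrans U \<in> carrier_mat n n"
      unfolding L by (auto intro!: mult_carrier_mat[of _ n n _ n])
    fix i j assume ij: "i < n" "j < n"
    have "complex_of_real (d i) * (ctrans U * V) $$ (i,j) = (ctrans U * V) $$ (i,j) * complex_of_real (e j)"
      using two_basis[OF U V ij] Ad Ae by metis
    then have "(ctrans U * V) $$ (i,j) = 0 \<or> d i = e j" by (auto simp: mult.commute)
    then show "(ctrans U * L * V) $$ (i,j)
        = (ctrans U * (U * mat_diag n (\<lambda>i. f (d i)) * ctrans U) * V) $$ (i,j)"
      unfolding L two_basis[OF U V ij] by auto
  qed
qed

lemma hermitian_spectralE:
  assumes "hermitian_mat n A"
  obtains U d where "has_spectral n A U d"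
  using hermitian_spectral[OF assms] unfolding has_spectral_def by blast

abbreviation fcalc :: "nat \<Rightarrow> (real \<Rightarrow> real) \<Rightarrow> complex mat
    \<Rightarrow> complex mat" where
  "fcalc n f A \<equiv> herm_fun_calc n (\<lambda>s. complex_of_real (f s)) A"

lemma fcalc_spectral:
  "has_spectral n A U d \<Longrightarrow> has_spectral n (fcalc n f A) U (\<lambda>i. f (d i))"
  unfolding has_spectral_def[of n "fcalc n f A"] using herm_fun_calc_eq[of n A U d]
  by (simp add: has_spectral_def)

lemma has_spectral_hermitian:
  assumes "has_spectral n A U d"
  shows "hermitian_mat n A"
proof -
  have U: "unitary_mat n U" and A: "A = U * diagr n d * ctrans U"
    using assms unfolding has_spectral_def by auto
  note [simp] = unitary_carrier[OF U] assoc_mult_mat[of _ n n _ n _ n] ctrans_mult[of _ n n _ n]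
  show ?thesis using has_spectral_carrier[OF assms] unfolding hermitian_mat_def A
    by (simp add: ctrans_mat_diag)
qed

lemma herm_fun_calc_carrier:
  assumes "hermitian_mat n A"
  shows "herm_fun_calc n f A \<in> carrier_mat n n"
proof -
  obtain U d where "has_spectral n A U d" using hermitian_spectralE[OF assms] .
  then show ?thesis using herm_fun_calc_eq[of n A U d f] unitary_carrier[of n U]
    unfolding has_spectral_def by (auto intro!: mult_carrier_mat[of _ n n _ n])
qed

lemma fcalc_hermitian:
  assumes "hermitian_mat n A"
  shows "hermitian_mat n (fcalc n f A)"
  by (metis assms fcalc_spectral has_spectral_hermitian hermitian_spectralE)

lemma fcalc_cong:
  assumes "has_spectral n A U d" "\<And>i. i < n \<Longrightarrow> f (d i) = g (d i)"
  shows "fcalc n f A = fcalc n g A"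
proof -
  have "mat_diag n (\<lambda>i. complex_of_real (f (d i))) = mat_diag n (\<lambda>i. complex_of_real (g (d i)))"
    using assms(2) by (auto simp: mat_diag_def)
  then show ?thesis using herm_fun_calc_eq[OF assms(1)] by simp
qed

lemma fcalc_id:
  assumes "has_spectral n A U d"
  shows "fcalc n (\<lambda>s. s) A = A"
  using herm_fun_calc_eq[OF assms] assms unfolding has_spectral_def by simp

lemma fcalc_const:
  assumes "hermitian_mat n A"
  shows "fcalc n (\<lambda>s. a) A = complex_of_real a \<cdot>\<^sub>m 1\<^sub>m n"
proof -
  obtain U d where s: "has_spectral n A U d" using hermitian_spectralE[OF assms] .
  then have U: "unitary_mat n U" unfolding has_spectral_def by simp
  have "mat_diag n (\<lambda>i. complex_of_real a) = complex_of_real a \<cdot>\<^sub>m 1\<^sub>m n"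
    by (rule eq_matI) (auto simp: mat_diag_def)
  then show ?thesis using herm_fun_calc_eq[OF s] unitary_carrier[OF U] unitary_inv_mult[OF U]
    by (simp add: mult_smult_distrib[of _ n n _ n] mult_smult_assoc_mat[of _ n n _ n])
qed

text \<open>The weights on the right are nonnegative, so scalar inequalities between eigenvalues can
  be summed termwise.\<close>

lemma hs_two_basis:
  assumes U: "unitary_mat n U" and V: "unitary_mat n V"
    and A: "A \<in> carrier_mat n n" and B: "B \<in> carrier_mat n n"
    and a: "\<And>i j. i < n \<Longrightarrow> j < n \<Longrightarrow>
        (ctrans U * A * V) $$ (i,j) = complex_of_real (a i j) * (ctrans U * V) $$ (i,j)"
    and b: "\<And>i j. i < n \<Longrightarrow> j < n \<Longrightarrow>
        (ctrans U * B * V) $$ (i,j) = complex_of_real (b i j) * (ctrans U * V) $$ (i,j)"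
  shows "hs A B = (\<Sum>i<n. \<Sum>j<n. a i j * b i j * (cmod ((ctrans U * V) $$ (i,j)))\<^sup>2)"
proof -
  note [simp] = unitary_carrier[OF U] unitary_carrier[OF V] A B
  have AB: "ctrans U * A * V \<in> carrier_mat n n" "ctrans U * B * V \<in> carrier_mat n n"
    by (auto intro!: mult_carrier_mat[of _ n n _ n])
  have *: "Re (cnj (complex_of_real r * z) * (complex_of_real s * z)) = r * s * (cmod z)\<^sup>2" for r s z
    unfolding cmod_power2 by (simp add: power2_eq_square algebra_simps)
  show ?thesis
    unfolding hs_unitary[OF U V A B, symmetric] hs_sum[OF AB]
    by (intro sum.cong refl) (simp only: a b * lessThan_iff)
qed

lemma has_spectral_entries:
  assumes "has_spectral n A U a" "has_spectral n B V b" "i < n" "j < n"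
  shows "(ctrans U * A * V) $$ (i,j) = complex_of_real (a i) * (ctrans U * V) $$ (i,j)"
    and "(ctrans U * B * V) $$ (i,j) = complex_of_real (b j) * (ctrans U * V) $$ (i,j)"
  using two_basis(1)[of n U V i j "\<lambda>i. complex_of_real (a i)"]
    two_basis(2)[of n U V i j "\<lambda>i. complex_of_real (b i)"] assms
  unfolding has_spectral_def by (auto simp: mult.commute)

lemma hs_diff_spectral:
  assumes A: "has_spectral n A U a" and B: "has_spectral n B V b"
    and A': "has_spectral n A' U a'" and B': "has_spectral n B' V b'"
  shows "hs (A - B) (A' - B') = (\<Sum>i<n. \<Sum>j<n. (a i - b j) * (a' i - b' j) * (cmod ((ctrans
      U * V) $$ (i,j)))\<^sup>2)"
proof -
  note [simp] = has_spectral_carrier[OF A] has_spectral_carrier[OF B]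
    has_spectral_carrier[OF A'] has_spectral_carrier[OF B']
  have U: "unitary_mat n U" and V: "unitary_mat n V" using A B unfolding has_spectral_def by auto
  note [simp] = unitary_carrier[OF U] unitary_carrier[OF V]
  have *: "(ctrans U * (A - B) * V) $$ (i,j) = complex_of_real (a i - b j) * (ctrans U * V) $$ (i,j)"
    if "has_spectral n A U a" "has_spectral n B V b" "i < n" "j < n" for A B a b i j
  proof -
    have "ctrans U * (A - B) * V = ctrans U * A * V - ctrans U * B * V"
      using has_spectral_carrier[OF that(1)] has_spectral_carrier[OF that(2)]
      by (simp add: minus_mult_distrib_mat[of _ n n _ _ n] mult_minus_distrib_mat[of _ n n _ n])
    moreover have "ctrans U * A * V \<in> carrier_mat n n" "ctrans U * B * V \<in> carrier_mat n n"
      using has_spectral_carrier[OF that(1)] has_spectral_carrier[OF that(2)]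
      by (auto intro!: mult_carrier_mat[of _ n n _ n])
    ultimately show ?thesis using has_spectral_entries[OF that] that(3,4)
      by (simp del: index_mult_mat add: left_diff_distrib)
  qed
  show ?thesis
    by (rule hs_two_basis[OF U V]) (use *[OF A B] *[OF A' B'] in auto)
qed

text \<open>In the mixed basis the difference has entries \<open>f (a i) - f (b j)\<close> times
  those of the transition matrix, so the scalar constant survives without loss. This is special to
  the Hilbert--Schmidt norm; in the operator norm it fails. Only values on the two spectra
  enter.\<close>

lemma fcalc_Lipschitz:
  assumes A: "has_spectral n A U a" and B: "has_spectral n B V b"
    and L: "\<And>i j. i < n \<Longrightarrow> j < n \<Longrightarrow>
        \<bar>f (a i) - f (b j)\<bar> \<le> L * \<bar>a i - b j\<bar>"
  shows "hs (fcalc n f A - fcalc n f B) (fcalc n f A - fcalc n f B) \<le> L\<^sup>2 * hs (A - B) (A - B)"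
proof -
  have "(f (a i) - f (b j)) * (f (a i) - f (b j)) \<le> L\<^sup>2 * ((a i - b j) * (a i - b j))"
      if "i < n" "j < n" for i j
  proof -
    have "\<bar>f (a i) - f (b j)\<bar>\<^sup>2 \<le> (L * \<bar>a i - b j\<bar>)\<^sup>2"
        by (rule power_mono[OF L[OF that]]) simp
    then show ?thesis by (simp add: power2_eq_square power_mult_distrib algebra_simps)
  qed
  then show ?thesis
    unfolding hs_diff_spectral[OF fcalc_spectral[OF A] fcalc_spectral[OF B] fcalc_spectral[OF A]
        fcalc_spectral[OF B]]
      hs_diff_spectral[OF A B A B] sum_distrib_left
    by (intro sum_mono) (metis lessThan_iff mult.assoc mult_right_mono zero_le_power2)
qed

text \<open>The trace of \<open>g A\<close>, written as a pairing with the identity so that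
  \<open>hs_two_basis\<close> applies to it.\<close>

definition trf :: "nat \<Rightarrow> (real \<Rightarrow> real) \<Rightarrow> complex mat
    \<Rightarrow> real" where
  "trf n g A = hs (1\<^sub>m n) (fcalc n g A)"

lemma mtrace_unitary_conj:
  assumes U: "unitary_mat n U" and A: "A \<in> carrier_mat n n"
  shows "mtrace (U * A * ctrans U) = mtrace A"
proof -
  note [simp] = unitary_carrier[OF U] A unitary_inv_mult[OF U]
    unitary_cancel[OF U, of _ n] assoc_mult_mat[of _ n n _ n _ n]
  have "mtrace ((U * A) * ctrans U) = mtrace (ctrans U * (U * A))"
    by (rule mtrace_mult_commute[of _ n]) auto
  then show ?thesis by simp
qed

lemma mtrace_spectral:
  assumes "has_spectral n A U d"
  shows "mtrace A = complex_of_real (\<Sum>i<n. d i)"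
  using mtrace_unitary_conj[of n U "diagr n d"] assms unfolding has_spectral_def
  by (auto simp: mtrace_def mat_diag_def)

lemma trf_spectral:
  assumes "has_spectral n A U d"
  shows "trf n g A = (\<Sum>i<n. g (d i))"
  using mtrace_spectral[OF fcalc_spectral[OF assms, of g]] has_spectral_carrier[OF
      fcalc_spectral[OF assms, of g]]
  unfolding trf_def hs_def by simp

text \<open>A quantitative form of Klein's inequality.\<close>
lemma trf_first_order:
  assumes A: "has_spectral n A U a" and B: "has_spectral n B V b"
    and g: "\<And>i j. i < n \<Longrightarrow> j < n \<Longrightarrow>
        \<bar>g (a i) - g (b j) - g' (b j) * (a i - b j)\<bar> \<le> K * (a i - b j)\<^sup>2"
  shows "\<bar>trf n g A - trf n g B - hs (fcalc n g' B) (A - B)\<bar> \<le> K * hs (A - B) (A - B)"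
proof -
  let ?W = "\<lambda>i j. (cmod ((ctrans U * V) $$ (i,j)))\<^sup>2"
  have U: "unitary_mat n U" and V: "unitary_mat n V" using A B unfolding has_spectral_def by auto
  note [simp] = unitary_carrier[OF U] unitary_carrier[OF V] has_spectral_carrier[OF A]
      has_spectral_carrier[OF B]
  note gA = fcalc_spectral[OF A] and gB = fcalc_spectral[OF B]
  note [simp] = has_spectral_carrier[OF gA] has_spectral_carrier[OF gB]
  have one: "(ctrans U * 1\<^sub>m n * V) $$ (i,j)
      = complex_of_real 1 * (ctrans U * V) $$ (i,j)" for i j by simp
  have 1: "trf n g A = (\<Sum>i<n. \<Sum>j<n. 1 * g (a i) * ?W i j)" unfolding trf_def
    by (rule hs_two_basis[OF U V _ _ one]) (use has_spectral_entries[OF gA B] in auto)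
  have 2: "trf n g B = (\<Sum>i<n. \<Sum>j<n. 1 * g (b j) * ?W i j)" unfolding trf_def
    by (rule hs_two_basis[OF U V _ _ one]) (use has_spectral_entries[OF A gB] in auto)
  have 3: "hs (fcalc n g' B) A = (\<Sum>i<n. \<Sum>j<n. g' (b j) * a i * ?W i j)"
    by (rule hs_two_basis[OF U V]) (use has_spectral_entries[OF A gB] has_spectral_entries[OF A B] in auto)
  have 4: "hs (fcalc n g' B) B = (\<Sum>i<n. \<Sum>j<n. g' (b j) * b j * ?W i j)"
    by (rule hs_two_basis[OF U V]) (use has_spectral_entries[OF A gB] has_spectral_entries[OF A B] in auto)
  have "trf n g A - trf n g B - hs (fcalc n g' B) (A - B)
      = (\<Sum>i<n. \<Sum>j<n. (g (a i) - g (b j) - g' (b j) * (a i - b j)) * ?W i j)"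
    by (simp add: hs_minus_right[of _ n] 1 2 3 4 sum_subtractf left_diff_distrib right_diff_distrib)
  also have "\<bar>\<dots>\<bar> \<le> (\<Sum>i<n. \<Sum>j<n. K * ((a i - b j) * (a i - b j) * ?W i j))"
  proof (rule order_trans[OF sum_abs], rule sum_mono, rule order_trans[OF sum_abs], rule sum_mono)
    fix i j assume "i \<in> {..<n}" "j \<in> {..<n}"
    then have "\<bar>g (a i) - g (b j) - g' (b j) * (a i - b j)\<bar> * ?W i j
        \<le> K * (a i - b j)\<^sup>2 * ?W i j"
      using g by (intro mult_right_mono) auto
    then show "\<bar>(g (a i) - g (b j) - g' (b j) * (a i - b j)) * ?W i j\<bar>
        \<le> K * ((a i - b j) * (a i - b j) * ?W i j)"
      by (simp add: abs_mult power2_eq_square mult.assoc)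
  qed
  also have "\<dots> = K * hs (A - B) (A - B)"
    unfolding hs_diff_spectral[OF A B A B] by (simp add: sum_distrib_left)
  finally show ?thesis .
qed


subsection \<open>Commutators and the Laplacian\<close>

definition commut :: "complex mat \<Rightarrow> complex mat \<Rightarrow> complex mat" where
  "commut Y A = Y * A - A * Y"

lemma commut_carrier[simp]:
  "Y \<in> carrier_mat n n \<Longrightarrow> A \<in> carrier_mat n n \<Longrightarrow>
      commut Y A \<in> carrier_mat n n"
  unfolding commut_def by simp

lemma uminus_mult_square:
  fixes A B :: "complex mat"
  assumes "A \<in> carrier_mat n n" "B \<in> carrier_mat n n"
  shows "- A * B = - (A * B)" "A * (- B) = - (A * B)"
  using assms by auto

lemma mat_diff_diff:
  fixes P Q R S :: "complex mat"
  assumes "P \<in> carrier_mat n n" "Q \<in> carrier_mat n n" "R \<in> carrier_mat n n" "S \<in>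
      carrier_mat n n"
  shows "(P - Q) - (R - S) = (P - R) - (Q - S)" "(P - Q) + (R - S) = (P + R) - (Q + S)"
  using assms by (auto intro!: eq_matI)

lemma mat_uminus_diff:
  fixes P Q :: "complex mat"
  assumes "P \<in> carrier_mat n n" "Q \<in> carrier_mat n n"
  shows "- (P - Q) = Q - P" "- P - (- Q) = Q - P" "- P + (- Q) = - (P + Q)"
  using assms by (auto intro!: eq_matI)

lemma commut_swap:
  "Y \<in> carrier_mat n n \<Longrightarrow> A \<in> carrier_mat n n \<Longrightarrow>
      commut A Y = - commut Y A"
  unfolding commut_def by (intro eq_matI) auto

lemma commut_minus:
  assumes "Y \<in> carrier_mat n n" "A \<in> carrier_mat n n" "B \<in> carrier_mat n n"
  shows "commut Y (A - B) = commut Y A - commut Y B"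
proof -
  have "Y * (A - B) = Y * A - Y * B" "(A - B) * Y = A * Y - B * Y"
    using assms by (auto simp: mult_minus_distrib_mat[of _ n n _ n] minus_mult_distrib_mat[of _ n n _ _ n])
  moreover have "Y * A \<in> carrier_mat n n" "Y * B \<in> carrier_mat n n"
     "A * Y \<in> carrier_mat n n" "B * Y \<in> carrier_mat n n" using assms by auto
  ultimately show ?thesis unfolding commut_def by (simp add: mat_diff_diff(1)[of _ n])
qed

lemma commut_scalar:
  assumes "Y \<in> carrier_mat n n"
  shows "commut Y (a \<cdot>\<^sub>m 1\<^sub>m n) = 0\<^sub>m n n"
  using assms unfolding commut_def
  by (simp add: mult_smult_distrib[of _ n n _ n] mult_smult_assoc_mat[of _ n n _ n])

lemma mtrace_commut:
  assumes "Y \<in> carrier_mat n n" "A \<in> carrier_mat n n"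
  shows "mtrace (commut Y A) = 0"
  using assms unfolding commut_def
  by (simp add: mtrace_minus[of _ n] mtrace_mult_commute[of Y n A])

lemma hs_commut:
  assumes Y: "hermitian_mat n Y" and A[simp]: "A \<in> carrier_mat n n" and B[simp]: "B \<in> carrier_mat n n"
  shows "hs A (commut Y B) = hs (commut Y A) B"
proof -
  note Yc[simp] = hermitian_carrier[OF Y]
  note [simp] = assoc_mult_mat[of _ n n _ n _ n]
  have "hs A (Y * B) = hs (Y * A) B"
    unfolding hs_def by (simp add: ctrans_mult[of _ n n _ n] hermitian_ctrans[OF Y])
  moreover have "hs A (B * Y) = hs (A * Y) B"
    using mtrace_mult_commute[of "ctrans A * B" n Y]
    unfolding hs_def by (simp add: ctrans_mult[of _ n n _ n] hermitian_ctrans[OF Y])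
  ultimately show ?thesis unfolding commut_def
    by (simp add: hs_minus_right[of _ n] hs_minus_left[of _ n])
qed

lemma hs_commut_self_le:
  assumes Y: "Y \<in> carrier_mat n n" and A: "A \<in> carrier_mat n n"
  shows "hs (commut Y A) (commut Y A) \<le> 4 * hs Y Y * hs A A"
proof -
  have "hs (commut Y A) (commut Y A) \<le> 2 * hs (Y * A) (Y * A) + 2 * hs (A * Y) (A * Y)"
    unfolding commut_def using Y A by (intro hs_minus_self_le[of _ n]) auto
  also have "\<dots> \<le> 2 * (hs Y Y * hs A A) + 2 * (hs A A * hs Y Y)"
    using hs_mult_self_le[OF Y A] hs_mult_self_le[OF A Y] by linarith
  finally show ?thesis by (simp add: mult.commute)
qed

text \<open>The minus sign in the second derivation cancels because the derivation is applied
  twice.\<close>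

lemma nc_laplacian_commut:
  assumes "x \<in> carrier_mat n n" "y \<in> carrier_mat n n" "a \<in> carrier_mat n n"
  shows "nc_laplacian x y a = commut y (commut y a) + commut x (commut x a)"
proof -
  have C: "commut x a \<in> carrier_mat n n" using assms by simp
  have "- (x * (- commut x a) - (- commut x a) * x) = commut x (commut x a)"
    using assms(1) C unfolding commut_def[of x "commut x a"]
    by (simp add: uminus_mult_square[of _ n] mat_uminus_diff[of _ n])
  then show ?thesis unfolding nc_laplacian_def Let_def commut_def by simp
qed

lemma nc_laplacian_carrier[simp]:
  assumes "x \<in> carrier_mat n n" "y \<in> carrier_mat n n" "a \<in> carrier_mat n n"
  shows "nc_laplacian x y a \<in> carrier_mat n n"
  using assms by (simp add: nc_laplacian_commut[of _ n])

lemma nc_laplacian_minus: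
  assumes "x \<in> carrier_mat n n" "y \<in> carrier_mat n n" "a \<in> carrier_mat n n" "b \<in>
      carrier_mat n n"
  shows "nc_laplacian x y (a - b) = nc_laplacian x y a - nc_laplacian x y b"
proof -
  have "nc_laplacian x y (a - b) = (commut y (commut y a) - commut y (commut y b)) +
      (commut x (commut x a) - commut x (commut x b))"
    using assms by (simp add: nc_laplacian_commut[of _ n] commut_minus[of _ n])
  moreover have "commut y (commut y a) \<in> carrier_mat n n" "commut y (commut y b) \<in> carrier_mat n n"
    "commut x (commut x a) \<in> carrier_mat n n" "commut x (commut x b) \<in> carrier_mat n n"
    using assms by simp_all
  ultimately show ?thesis using assms
    by (simp add: nc_laplacian_commut[of _ n] mat_diff_diff(2)[of _ n])
qed

lemma mtrace_nc_laplacian: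
  assumes "x \<in> carrier_mat n n" "y \<in> carrier_mat n n" "a \<in> carrier_mat n n"
  shows "mtrace (nc_laplacian x y a) = 0"
  using assms by (simp add: nc_laplacian_commut[of _ n] mtrace_add[of _ n] mtrace_commut[of _ n])

lemma commut_ctrans:
  assumes Y: "hermitian_mat n Y" and A: "A \<in> carrier_mat n n"
  shows "ctrans (commut Y A) = - commut Y (ctrans A)"
  using A hermitian_carrier[OF Y] unfolding commut_def
  by (simp add: ctrans_minus[of _ n n] ctrans_mult[of _ n n _ n] hermitian_ctrans[OF Y]
      mat_uminus_diff(1)[of _ n])

lemma commut_uminus:
  assumes "Y \<in> carrier_mat n n" "A \<in> carrier_mat n n"
  shows "commut Y (- A) = - commut Y A"
  using assms unfolding commut_def
  by (simp add: uminus_mult_square[of _ n] mat_uminus_diff[of _ n])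

lemma nc_laplacian_hermitian:
  assumes x: "hermitian_mat n x" and y: "hermitian_mat n y" and a: "hermitian_mat n a"
  shows "hermitian_mat n (nc_laplacian x y a)"
  using hermitian_carrier[OF x] hermitian_carrier[OF y] hermitian_carrier[OF a] unfolding hermitian_mat_def
  by (simp add: nc_laplacian_commut[of _ n] ctrans_add[of _ n n] commut_ctrans[OF x] commut_ctrans[OF y]
     commut_uminus[of _ n] hermitian_ctrans[OF a])

text \<open>The Dirichlet form: commutators with Hermitian matrices are symmetric for
  \<open>hs\<close>, so one of each pair moves to the other side.\<close>

lemma hs_nc_laplacian:
  assumes x: "hermitian_mat n x" and y: "hermitian_mat n y"
    and a: "a \<in> carrier_mat n n" and b: "b \<in> carrier_mat n n"
  shows "hs a (nc_laplacian x y b) = hs (commut y a) (commut y b) + hs (commut x a) (commut x b)"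
  using hermitian_carrier[OF x] hermitian_carrier[OF y] a b
  by (simp add: nc_laplacian_commut[of _ n] hs_add_right[of _ n] hs_commut[OF x] hs_commut[OF y])

text \<open>Each commutator with \<open>z\<close> costs \<open>4 * hs z z\<close>, two of them 16
  times the square, and the sum of two terms a further factor 2.\<close>

lemma nc_laplacian_bounded:
  assumes x: "x \<in> carrier_mat n n" and y: "y \<in> carrier_mat n n" and a: "a \<in> carrier_mat n n"
  shows "hs (nc_laplacian x y a) (nc_laplacian x y a)
      \<le> (32 * ((hs x x)\<^sup>2 + (hs y y)\<^sup>2)) * hs a a"
proof -
  have *: "hs (commut z (commut z a)) (commut z (commut z a)) \<le> 16 * (hs z z)\<^sup>2 * hs a a"
    if z: "z \<in> carrier_mat n n" for z
  proof -
    have "hs (commut z (commut z a)) (commut z (commut z a)) \<le> 4 * hs z z * hs (commut z a) (commut z a)"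
      using z a by (intro hs_commut_self_le[of _ n]) auto
    also have "\<dots> \<le> 4 * hs z z * (4 * hs z z * hs a a)"
      using hs_commut_self_le[OF z a] hs_self_nonneg[OF z] by (intro mult_left_mono) auto
    finally show ?thesis by (simp add: power2_eq_square mult.assoc)
  qed
  have "hs (nc_laplacian x y a) (nc_laplacian x y a)
      \<le> 2 * (16 * (hs y y)\<^sup>2 * hs a a) + 2 * (16 * (hs x x)\<^sup>2 * hs a a)"
    unfolding nc_laplacian_commut[OF x y a]
    by (rule order_trans[OF hs_add_self_le[of _ n]]) (use x y a *[OF x] *[OF y] in auto)
  then show ?thesis by (simp add: algebra_simps)
qed

text \<open>In the eigenbasis the commutator has the entries of \<open>Y\<close> times
  \<open>f j - f i\<close>. The coefficients are complex to cover the exponentials of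
  \<open>x\<close> and \<open>y\<close> as well.\<close>

lemma hs_commut_diag:
  assumes U: "unitary_mat n U" and Y[simp]: "Y \<in> carrier_mat n n"
  shows "hs (commut Y (U * mat_diag n f * ctrans U)) (commut Y (U * mat_diag n g * ctrans U)) =
    (\<Sum>i<n. \<Sum>j<n. (cmod ((ctrans U * Y * U) $$ (i,j)))\<^sup>2 * Re (cnj (f j - f i) * (g j - g i)))"
proof -
  note [simp] = unitary_carrier[OF U]
  have *: "(ctrans U * commut Y (U * mat_diag n f * ctrans U) * U) $$ (i,j)
      = (ctrans U * Y * U) $$ (i,j) * (f j - f i)" if ij: "i < n" "j < n" for f i j
  proof -
    have W: "ctrans U * Y * U \<in> carrier_mat n n" by simp
    have c: "(ctrans U * Y * U) * mat_diag n f \<in> carrier_mat n n" "mat_diag n f * (ctrans U * Y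
        * U) \<in> carrier_mat n n" by simp_all
    have "ctrans U * commut Y (U * mat_diag n f * ctrans U) * U =
        (ctrans U * Y * U) * mat_diag n f - mat_diag n f * (ctrans U * Y * U)"
      unfolding commut_def
      by (simp add: unitary_inv_mult[OF U] unitary_cancel[OF U, of _ n] assoc_mult_mat[of _ n n _ n _ n]
         mult_minus_distrib_mat[of _ n n _ n] minus_mult_distrib_mat[of _ n n _ _ n])
    then have "(ctrans U * commut Y (U * mat_diag n f * ctrans U) * U) $$ (i,j) =
        ((ctrans U * Y * U) * mat_diag n f) $$ (i,j) - (mat_diag n f * (ctrans U * Y * U)) $$ (i,j)"
      using c ij carrier_matD[OF c(2)] by (simp del: index_mult_mat)
    also have "\<dots> = (ctrans U * Y * U) $$ (i,j) * (f j - f i)"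
      unfolding mat_diag_mult_left[OF W] mat_diag_mult_right[OF W] using ij by (simp add: algebra_simps)
    finally show ?thesis .
  qed
  have c: "commut Y (U * mat_diag n f * ctrans U) \<in> carrier_mat n n" for f by simp
  have c2: "ctrans U * commut Y (U * mat_diag n f * ctrans U) * U \<in> carrier_mat n n" for f by simp
  have **: "Re (cnj (z * a) * (z * b)) = (cmod z)\<^sup>2 * Re (cnj a * b)" for z a b
    unfolding cmod_power2 by (simp add: power2_eq_square algebra_simps)
  show ?thesis
    unfolding hs_unitary[OF U U c c, symmetric] hs_sum[OF c2 c2]
    by (intro sum.cong refl) (simp only: * ** lessThan_iff)
qed

lemma hs_commut_fcalc:
  assumes A: "has_spectral n A U d" and Y: "Y \<in> carrier_mat n n"
  shows "hs (commut Y (fcalc n f A)) (commut Y (fcalc n g A)) =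
    (\<Sum>i<n. \<Sum>j<n. (cmod ((ctrans U * Y * U) $$ (i,j)))\<^sup>2 * ((f (d j) - f (d i)) * (g
        (d j) - g (d i))))"
proof -
  have U: "unitary_mat n U" using A unfolding has_spectral_def by simp
  show ?thesis unfolding herm_fun_calc_eq[OF A] hs_commut_diag[OF U Y] by simp
qed

text \<open>The device that turns scalar inequalities into inequalities between Dirichlet forms. The
  factors \<open>k\<close> and \<open>k'\<close> may have any sign, as the determinant estimate
  requires.\<close>

lemma hs_laplacian_fcalc_mono:
  assumes x: "hermitian_mat n x" and y: "hermitian_mat n y" and A: "has_spectral n A U d"
    and le: "\<And>i j. i < n \<Longrightarrow> j < n \<Longrightarrow>
      k * ((f (d j) - f (d i)) * (g (d j) - g (d i)))
          \<le> k' * ((f' (d j) - f' (d i)) * (g' (d j) - g' (d i)))"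
  shows "k * hs (fcalc n f A) (nc_laplacian x y (fcalc n g A))
      \<le> k' * hs (fcalc n f' A) (nc_laplacian x y (fcalc n g' A))"
proof -
  have c: "fcalc n h A \<in> carrier_mat n n" for h
    by (rule herm_fun_calc_carrier[OF has_spectral_hermitian[OF A]])
  have "k * hs (commut Y (fcalc n f A)) (commut Y (fcalc n g A))
      \<le> k' * hs (commut Y (fcalc n f' A)) (commut Y (fcalc n g' A))"
    if "Y \<in> carrier_mat n n" for Y
    unfolding hs_commut_fcalc[OF A that] sum_distrib_left mult.left_commute[of _ "_\<^sup>2"]
    by (intro sum_mono mult_left_mono le) auto
  from this[OF hermitian_carrier[OF x]] this[OF hermitian_carrier[OF y]]
  show ?thesis unfolding hs_nc_laplacian[OF x y c c] by (simp add: distrib_left)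
qed

subsection \<open>The spectral gap\<close>

lemma commut_herm_fun_calc_le:
  assumes x: "hermitian_mat n x" and a: "a \<in> carrier_mat n n"
    and L: "\<And>s t. cmod (e s - e t) \<le> L * \<bar>s - t\<bar>"
  shows "hs (commut (herm_fun_calc n e x) a) (commut (herm_fun_calc n e x) a)
      \<le> L\<^sup>2 * hs (commut x a) (commut x a)"
proof -
  obtain U d where s: "has_spectral n x U d" using hermitian_spectralE[OF x] .
  have U: "unitary_mat n U" and xU: "x = U * diagr n d * ctrans U" using s unfolding has_spectral_def by auto
  note c = herm_fun_calc_carrier[OF x, of e]
  \<comment> \<open>The exchange puts the function of \<open>x\<close> into the slot that
    \<open>hs_commut_diag\<close> diagonalizes, while \<open>a\<close> supplies the weights.\<close>
  have sw: "hs (commut z a) (commut z a) = hs (commut a z) (commut a z)" if "z \<in> carrier_mat n n" for z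
    unfolding commut_swap[OF that a] using that a by (simp add: hs_uminus_self[of _ n])
  have "hs (commut a (herm_fun_calc n e x)) (commut a (herm_fun_calc n e x)) =
    (\<Sum>i<n. \<Sum>j<n. (cmod ((ctrans U * a * U) $$ (i,j)))\<^sup>2 * (cmod (e (d j) - e (d i)))\<^sup>2)"
    unfolding herm_fun_calc_eq[OF s] hs_commut_diag[OF U a]
    by (intro sum.cong refl arg_cong2[where f="(*)"]) (metis Re_complex_of_real complex_norm_square
        mult.commute)
  also have "\<dots> \<le> (\<Sum>i<n. \<Sum>j<n. (cmod ((ctrans U * a * U) $$ (i,j)))\<^sup>2 *
      (L\<^sup>2 * (d j - d i)\<^sup>2))"
  proof (intro sum_mono mult_left_mono)
    fix i j
    have "(cmod (e (d j) - e (d i)))\<^sup>2 \<le> (L * \<bar>d j - d i\<bar>)\<^sup>2"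
        by (rule power_mono[OF L]) simp
    then show "(cmod (e (d j) - e (d i)))\<^sup>2 \<le> L\<^sup>2 * (d j - d i)\<^sup>2"
        by (simp add: power_mult_distrib)
  qed auto
  also have "\<dots> = L\<^sup>2 * hs (commut a x) (commut a x)"
    using hs_commut_diag[OF U a, of "\<lambda>i. complex_of_real (d i)" "\<lambda>i. complex_of_real (d i)"]
    unfolding xU[symmetric] by (simp add: sum_distrib_left power2_eq_square mult.left_commute)
  finally show ?thesis unfolding sw[OF c] sw[OF hermitian_carrier[OF x]] .
qed

text \<open>A chord of the unit circle is no longer than its arc.\<close>

lemma exp_2pii_over_Lipschitz:
  "cmod (exp (2 * pi * \<i> * complex_of_real s / of_nat n) - exp (2 * pi * \<i> * complex_of_real
      t / of_nat n))
    \<le> 2 * pi / real n * \<bar>s - t\<bar>"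
proof -
  define r where "r = 2 * pi * (s - t) / real n"
  have "exp (2 * pi * \<i> * complex_of_real s / of_nat n) - exp (2 * pi * \<i> * complex_of_real t / of_nat n)
    = exp (\<i> * complex_of_real (2 * pi * t / real n)) * (exp (\<i> * complex_of_real r) - 1)"
    unfolding r_def right_diff_distrib exp_add[symmetric]
    by (simp add: field_simps diff_divide_distrib exp_add[symmetric])
  then have "cmod (exp (2 * pi * \<i> * complex_of_real s / of_nat n) - exp (2 * pi * \<i> *
      complex_of_real t / of_nat n))
    = 2 * \<bar>sin (r / 2)\<bar>"
    using dist_exp_i_1[of r] by (simp add: norm_mult)
  also have "\<dots> \<le> \<bar>r\<bar>" using abs_sin_x_le_abs_x[of "r / 2"] by simp
  also have "\<dots> = 2 * pi / real n * \<bar>s - t\<bar>" unfolding r_def by (simp add: abs_mult)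
  finally show ?thesis .
qed

text \<open>Coprimality makes the root of unity primitive, so its first \<open>n\<close> powers
  differ and \<open>u\<close> has simple spectrum.\<close>

lemma u_mat_powers_distinct:
  assumes "coprime m n" "n > 0" "i < n" "j < n" "i \<noteq> j"
  shows "exp (2 * pi * \<i> * of_nat m / of_nat n) ^ i \<noteq> exp (2 * pi * \<i> * of_nat m / of_nat n) ^ j"
proof
  assume eq: "exp (2 * pi * \<i> * of_nat m / of_nat n) ^ i = exp (2 * pi * \<i> * of_nat m / of_nat n) ^ j"
  have p: "exp (2 * pi * \<i> * of_nat m / of_nat n) ^ k
      = exp (2 * of_real pi * \<i> * of_nat (k * m) / of_nat n)" for k
    by (simp add: exp_of_nat_mult[symmetric] mult_ac)
  have "(i * m) mod n = (j * m) mod n"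
    using eq assms(2) unfolding p by (subst (asm) complex_root_unity_eq) auto
  then have "(int i * int m) mod int n = (int j * int m) mod int n" by (metis of_nat_mod of_nat_mult)
  then have "int n dvd (int i - int j) * int m" by (simp add: mod_eq_dvd_iff left_diff_distrib)
  moreover have "coprime (int n) (int m)" using assms(1) by (simp add: coprime_commute)
  ultimately have "int n dvd int i - int j" by (simp add: coprime_dvd_mult_left_iff)
  then have "int n \<le> \<bar>int i - int j\<bar>" using assms(5)
      by (intro dvd_imp_le_int[of "int i - int j" "int n", simplified]) auto
  then show False using assms(3,4) by linarith
qed

lemma diag_consecutive_bound:
  fixes b :: "nat \<Rightarrow> complex"
  assumes "\<And>i. Suc i < n \<Longrightarrow> cmod (b (Suc i) - b i) \<le> e"
  shows "i < n \<Longrightarrow> cmod (b i - b 0) \<le> real i * e"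
proof (induction i)
  case (Suc i)
  have "cmod (b (Suc i) - b 0) \<le> cmod (b (Suc i) - b i) + cmod (b i - b 0)"
    using norm_triangle_ineq[of "b (Suc i) - b i" "b i - b 0"] by simp
  also have "\<dots> \<le> e + real i * e" using Suc assms by (intro add_mono) auto
  finally show ?case by (simp add: algebra_simps)
qed simp

lemma uv_gap:
  assumes n: "n \<ge> 2" and cop: "coprime m n"
  shows "\<exists>k>0. \<forall>a\<in>carrier_mat n n.
    hs (a - (mtrace a / of_nat n) \<cdot>\<^sub>m 1\<^sub>m n) (a - (mtrace a / of_nat n)
        \<cdot>\<^sub>m 1\<^sub>m n)
    \<le> k * (hs (commut (u_mat n m) a) (commut (u_mat n m) a) + hs (commut (v_mat n) a) (commut (v_mat n) a))"
proof -
  define q where "q = exp (2 * pi * \<i> * of_nat m / of_nat n)"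
  define I where "I = {(i,j). i < n \<and> j < n \<and> i \<noteq> j}"
  define D where "D = Min ((\<lambda>(i,j). cmod (q ^ i - q ^ j)) ` I)"
  have "I \<subseteq> {..<n} \<times> {..<n}" unfolding I_def by auto
  then have fin: "finite I" by (rule finite_subset) simp
  have "(0,1) \<in> I" using n unfolding I_def by simp
  then have ne: "I \<noteq> {}" by auto
  have D0: "D > 0" unfolding D_def using fin ne u_mat_powers_distinct[OF cop] n
    by (subst Min_gr_iff) (auto simp: I_def q_def)
  have D: "D \<le> cmod (q ^ i - q ^ j)" if "i < n" "j < n" "i \<noteq> j" for i j
    unfolding D_def using fin that by (intro Min_le) (auto simp: I_def)
  \<comment> \<open>There are \<open>n * n\<close> entries. The first summand covers an off-diagonal
    one, \<open>D\<close> being the least distance between powers of \<open>q\<close>; the second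
    covers a diagonal one, which is at most \<open>2 * n * sqrt ?E\<close>.\<close>
  define k where "k = real n * real n * (1 / D\<^sup>2 + 4 * (real n)\<^sup>2)"
  have "k > 0" unfolding k_def using n D0 by (intro mult_pos_pos add_pos_pos) auto
  moreover have "hs (a - (mtrace a / of_nat n) \<cdot>\<^sub>m 1\<^sub>m n) (a - (mtrace a / of_nat
      n) \<cdot>\<^sub>m 1\<^sub>m n)
    \<le> k * (hs (commut (u_mat n m) a) (commut (u_mat n m) a) + hs (commut (v_mat n) a) (commut (v_mat n) a))"
    (is "_ \<le> k * ?E") if a[simp]: "a \<in> carrier_mat n n" for a
  proof -
    have u[simp]: "u_mat n m \<in> carrier_mat n n" unfolding u_mat_def by simp
    have v[simp]: "v_mat n \<in> carrier_mat n n" unfolding v_mat_def by simp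
    have E0: "hs (commut (u_mat n m) a) (commut (u_mat n m) a) \<ge> 0" "hs (commut (v_mat n) a)
        (commut (v_mat n) a) \<ge> 0"
      by (auto intro!: hs_self_nonneg[of _ n])
    define c where "c = mtrace a / of_nat n"
    define N where "N = a - c \<cdot>\<^sub>m 1\<^sub>m n"
    have N[simp]: "N \<in> carrier_mat n n" unfolding N_def by simp
    have off: "(cmod (N $$ (i,j)))\<^sup>2 \<le> ?E / D\<^sup>2" if ij: "i < n" "j < n" "i \<noteq> j" for i j
    proof -
      have "commut (u_mat n m) a $$ (i,j) = (q ^ i - q ^ j) * a $$ (i,j)"
        using ij unfolding commut_def u_mat_def mat_diag_mult_left[OF a] mat_diag_mult_right[OF a]
        by (simp add: q_def algebra_simps)
      then have "(cmod (q ^ i - q ^ j))\<^sup>2 * (cmod (a $$ (i,j)))\<^sup>2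
          \<le> hs (commut (u_mat n m) a) (commut (u_mat n m) a)"
        using entry_le_hs[of "commut (u_mat n m) a" n i j] ij by (simp add: norm_mult power_mult_distrib)
      moreover have "D\<^sup>2 * (cmod (a $$ (i,j)))\<^sup>2
          \<le> (cmod (q ^ i - q ^ j))\<^sup>2 * (cmod (a $$ (i,j)))\<^sup>2"
        using D[OF ij] D0 by (intro mult_right_mono power_mono) auto
      ultimately have "D\<^sup>2 * (cmod (a $$ (i,j)))\<^sup>2 \<le> ?E" using E0 by linarith
      moreover have "N $$ (i,j) = a $$ (i,j)" using ij carrier_matD[OF a] unfolding N_def by simp
      ultimately show ?thesis using D0 by (simp add: pos_le_divide_eq mult.commute)
    qed
    have step: "cmod (a $$ (Suc i,Suc i) - a $$ (i,i)) \<le> sqrt ?E" if i: "Suc i < n" for i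
    proof -
      have "(v_mat n * a) $$ (i, Suc i) = (\<Sum>l<n. (if l = Suc i then a $$ (l, Suc i) else 0))"
        using i unfolding index_mult_mat_sum[OF v a Suc_lessD[OF i] i]
        by (intro sum.cong refl) (auto simp: v_mat_def)
      then have 1: "(v_mat n * a) $$ (i, Suc i) = a $$ (Suc i, Suc i)" using i by simp
      have "(a * v_mat n) $$ (i, Suc i) = (\<Sum>l<n. (if l = i then a $$ (i, l) else 0))"
      proof (subst index_mult_mat_sum[OF a v])
        show "i < n" "Suc i < n" using i by auto
        show "(\<Sum>l<n. a $$ (i, l) * v_mat n $$ (l, Suc i)) = (\<Sum>l<n. (if l
            = i then a $$ (i, l) else 0))"
        proof (intro sum.cong refl)
          fix l assume "l \<in> {..<n}"
          then have l: "l < n" by simp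
          \<comment> \<open>The wrap-around row \<open>l = n - 1\<close> has its one in column
            \<open>0\<close>, never in column \<open>Suc i\<close>.\<close>
          have "(Suc i = Suc l mod n) \<longleftrightarrow> l = i"
            using l i by (cases "Suc l = n") auto
          then show "a $$ (i, l) * v_mat n $$ (l, Suc i) = (if l = i then a $$ (i, l) else 0)"
            using l i by (simp add: v_mat_def)
        qed
      qed
      then have 2: "(a * v_mat n) $$ (i, Suc i) = a $$ (i,i)" using i by simp
      have "commut (v_mat n) a $$ (i, Suc i) = a $$ (Suc i, Suc i) - a $$ (i,i)"
        using 1 2 i carrier_matD[OF a] carrier_matD[OF v] unfolding commut_def by (simp del: index_mult_mat(1))
      then have "(cmod (a $$ (Suc i, Suc i) - a $$ (i,i)))\<^sup>2 \<le> ?E"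
        using entry_le_hs[of "commut (v_mat n) a" n i "Suc i"] i E0 by simp
      then show ?thesis by (simp add: real_le_rsqrt)
    qed
    have d0: "cmod (a $$ (i,i) - a $$ (0,0)) \<le> real n * sqrt ?E" if i: "i < n" for i
    proof -
      have "cmod (a $$ (i,i) - a $$ (0,0)) \<le> real i * sqrt ?E"
        by (rule diag_consecutive_bound[of n "\<lambda>i. a $$ (i,i)"]) (use step i in auto)
      also have "\<dots> \<le> real n * sqrt ?E" using i E0 by (intro mult_right_mono) auto
      finally show ?thesis .
    qed
    have diag: "(cmod (N $$ (i,i)))\<^sup>2 \<le> 4 * (real n)\<^sup>2 * ?E" if i: "i < n" for i
    proof -
      \<comment> \<open>The deviation from the mean is the average of the differences to all
        diagonal entries; each is bounded through the entry at \<open>(0,0)\<close>, which doubles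
        the bound.\<close>
      have "of_nat n * N $$ (i,i) = (\<Sum>j<n. a $$ (i,i) - a $$ (j,j))"
        using i n carrier_matD[OF a] unfolding N_def c_def mtrace_def by (simp add: sum_subtractf field_simps)
      then have "real n * cmod (N $$ (i,i)) = cmod (\<Sum>j<n. a $$ (i,i) - a $$ (j,j))"
        by (metis norm_mult norm_of_nat)
      also have "\<dots> \<le> (\<Sum>j<n. 2 * (real n * sqrt ?E))"
      proof (rule order_trans[OF norm_sum], rule sum_mono)
        fix j assume "j \<in> {..<n}"
        then have j: "j < n" by simp
        have "cmod (a $$ (i,i) - a $$ (j,j))
            \<le> cmod (a $$ (i,i) - a $$ (0,0)) + cmod (a $$ (j,j) - a $$ (0,0))"
          using norm_triangle_ineq4[of "a $$ (i,i) - a $$ (0,0)" "a $$ (j,j) - a $$ (0,0)"] by simp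
        then show "cmod (a $$ (i,i) - a $$ (j,j)) \<le> 2 * (real n * sqrt ?E)"
            using d0[OF i] d0[OF j] by linarith
      qed
      also have "\<dots> = real n * (2 * (real n * sqrt ?E))" by simp
      finally have "cmod (N $$ (i,i)) \<le> 2 * (real n * sqrt ?E)" using n by simp
      then have "(cmod (N $$ (i,i)))\<^sup>2 \<le> (2 * (real n * sqrt ?E))\<^sup>2" by (rule power_mono) simp
      also have "\<dots> = 4 * (real n)\<^sup>2 * ?E" using E0 by (simp add: power_mult_distrib)
      finally show ?thesis .
    qed
    have "hs N N \<le> (\<Sum>i<n. \<Sum>j<n. (1 / D\<^sup>2 + 4 * (real n)\<^sup>2) * ?E)"
      unfolding hs_self_sum[OF N]
    proof (intro sum_mono)
      fix i j assume "i \<in> {..<n}" "j \<in> {..<n}"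
      moreover have "0 \<le> ?E / D\<^sup>2" "0 \<le> 4 * (real n)\<^sup>2 * ?E" using E0 by auto
      ultimately have "(cmod (N $$ (i,j)))\<^sup>2 \<le> ?E / D\<^sup>2 + 4 * (real n)\<^sup>2 * ?E"
        using off[of i j] diag[of i] by (cases "i = j") auto
      also have "\<dots> = (1 / D\<^sup>2 + 4 * (real n)\<^sup>2) * ?E" by (simp add: distrib_right)
      finally show "(cmod (N $$ (i,j)))\<^sup>2 \<le> (1 / D\<^sup>2 + 4 * (real n)\<^sup>2) * ?E" .
    qed
    also have "\<dots> = k * ?E" unfolding k_def by simp
    finally show ?thesis unfolding N_def c_def .
  qed
  ultimately show ?thesis by blast
qed

lemma laplacian_gap:
  assumes n: "n \<ge> 2" and cop: "coprime m n"
    and x: "hermitian_mat n x" and y: "hermitian_mat n y"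
    and u: "u_mat n m = exp_2pii_over n x" and v: "v_mat n = exp_2pii_over n y"
  shows "\<exists>k>0. \<forall>a\<in>carrier_mat n n.
    hs (a - (mtrace a / of_nat n) \<cdot>\<^sub>m 1\<^sub>m n) (a - (mtrace a / of_nat n)
        \<cdot>\<^sub>m 1\<^sub>m n)
    \<le> k * hs a (nc_laplacian x y a)"
proof -
  obtain k where k: "k > 0" and gap: "\<And>a. a \<in> carrier_mat n n \<Longrightarrow>
    hs (a - (mtrace a / of_nat n) \<cdot>\<^sub>m 1\<^sub>m n) (a - (mtrace a / of_nat n)
        \<cdot>\<^sub>m 1\<^sub>m n)
    \<le> k * (hs (commut (u_mat n m) a) (commut (u_mat n m) a) + hs (commut (v_mat n) a) (commut (v_mat n) a))"
    using uv_gap[OF n cop] by blast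
  let ?L = "(2 * pi / real n)\<^sup>2"
  have L: "?L > 0" using n by simp
  have "hs (a - (mtrace a / of_nat n) \<cdot>\<^sub>m 1\<^sub>m n) (a - (mtrace a / of_nat n)
      \<cdot>\<^sub>m 1\<^sub>m n)
    \<le> (k * ?L) * hs a (nc_laplacian x y a)" if a: "a \<in> carrier_mat n n" for a
  proof -
    note xu = commut_herm_fun_calc_le[OF x a exp_2pii_over_Lipschitz[of _ n], folded exp_2pii_over_def u]
    note yv = commut_herm_fun_calc_le[OF y a exp_2pii_over_Lipschitz[of _ n], folded exp_2pii_over_def v]
    have "k * (hs (commut (u_mat n m) a) (commut (u_mat n m) a) + hs (commut (v_mat n) a) (commut (v_mat n) a))
      \<le> k * (?L * hs (commut x a) (commut x a) + ?L * hs (commut y a) (commut y a))"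
      using xu yv k by (intro mult_left_mono add_mono) auto
    also have "\<dots> = (k * ?L) * hs a (nc_laplacian x y a)"
      unfolding hs_nc_laplacian[OF x y a a] by (simp add: algebra_simps)
    finally show ?thesis using gap[OF a] by linarith
  qed
  then show ?thesis using k L by (intro exI[of _ "k * ?L"]) auto
qed

subsection \<open>Strict positivity and determinant in an eigenbasis\<close>

lemma has_spectral_similar:
  assumes "has_spectral n A U d"
  shows "similar_mat A (diagr n d)"
proof -
  have U: "unitary_mat n U" and A: "A = U * diagr n d * ctrans U" using assms unfolding has_spectral_def by auto
  have "similar_mat_wit A (diagr n d) U (ctrans U)"
    using unitary_inv_mult[OF U] unitary_carrier[OF U] has_spectral_carrier[OF assms] A
    by (intro similar_mat_witI[of _ _ n]) auto
  then show ?thesis unfolding similar_mat_def by blast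
qed

lemma diag_mat_diagr: "diag_mat (mat_diag n f) = map f [0..<n]"
  by (auto simp: diag_mat_def mat_diag_def)

lemma upper_triangular_mat_diag: "upper_triangular (mat_diag n f)"
  by (auto simp: upper_triangular_def mat_diag_def)

lemma det_spectral:
  assumes "has_spectral n A U d"
  shows "det A = complex_of_real (\<Prod>i<n. d i)"
  unfolding det_similar[OF has_spectral_similar[OF assms]]
    det_upper_triangular[OF upper_triangular_mat_diag mat_diag_dim] diag_mat_diagr
  by (simp add: prod.list_conv_set_nth atLeast0LessThan)

lemma eigenvalue_spectral:
  assumes "has_spectral n A U d"
  shows "eigenvalue A k \<longleftrightarrow> (\<exists>i<n. k = complex_of_real (d i))"
  unfolding eigenvalue_root_char_poly[OF has_spectral_carrier[OF assms]]
    char_poly_similar[OF has_spectral_similar[OF assms]]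
    char_poly_upper_triangular[OF mat_diag_dim upper_triangular_mat_diag] diag_mat_diagr
  by (auto simp: poly_prod_list prod_list_zero_iff)

lemma strictly_pos_spectral:
  assumes "has_spectral n A U d"
  shows "strictly_pos_mat n A \<longleftrightarrow> (\<forall>i<n. 0 < d i)"
  unfolding strictly_pos_mat_def eigenvalue_spectral[OF assms] using has_spectral_hermitian[OF assms] by auto


subsection \<open>Global solutions of Lipschitz differential equations\<close>

lemma integral_has_vector_derivative_atLeast:
  fixes f :: "real \<Rightarrow> 'a :: banach"
  assumes f: "continuous_on UNIV f" and t: "t \<ge> a"
  shows "((\<lambda>u. integral {a..u} f) has_vector_derivative f t) (at t within {a..})"
proof -
  have "((\<lambda>u. integral {a..u} f) has_vector_derivative f t) (at t within {a..t+1})"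
    using t by (intro integral_has_vector_derivative continuous_on_subset[OF f]) auto
  moreover have "at t within {a..t+1} = at t within {a..}"
    by (rule at_within_nhd[of t "{..<t+1}"]) auto
  ultimately show ?thesis by simp
qed

text \<open>Integration against the exponential weight gains the factor \<open>1 / K\<close>, which
  beats the Lipschitz constant in the contraction estimate.\<close>

lemma norm_integral_le_exp:
  fixes h :: "real \<Rightarrow> 'a :: banach"
  assumes h: "continuous_on UNIV h" and K: "K > 0" and C: "C \<ge> 0" and t: "t \<ge> a"
    and le: "\<And>s. s \<ge> a \<Longrightarrow> norm (h s) \<le> C * exp (K * (s - a))"
  shows "norm (integral {a..t} h) \<le> C / K * exp (K * (t - a))"
proof -
  have "((\<lambda>s. C * exp (K * (s - a))) has_integral (C / K * exp (K * (t - a)) - C / K * exp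
      (K * (a - a)))) {a..t}"
  proof (rule fundamental_theorem_of_calculus[OF t])
    fix s
    have "((\<lambda>s. C / K * exp (K * (s - a))) has_real_derivative C * exp (K * (s - a)))
        (at s within {a..t})"
      using K by (auto intro!: derivative_eq_intros)
    then show "((\<lambda>s. C / K * exp (K * (s - a))) has_vector_derivative C * exp (K * (s -
        a))) (at s within {a..t})"
      by (simp add: has_real_derivative_iff_has_vector_derivative)
  qed
  then have I: "(\<lambda>s. C * exp (K * (s - a))) integrable_on {a..t}"
    "integral {a..t} (\<lambda>s. C * exp (K * (s - a))) = C / K * exp (K * (t - a)) - C / K"
    by (auto simp: has_integral_integrable_integral)
  have "norm (integral {a..t} h) \<le> integral {a..t} (\<lambda>s. C * exp (K * (s - a)))"
    by (rule integral_norm_bound_integral[OF integrable_continuous_real[OF continuous_on_subset[OF h]] I(1)])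
      (use le in auto)
  also have "\<dots> \<le> C / K * exp (K * (t - a))" unfolding I(2) using C K by simp
  finally show ?thesis .
qed

text \<open>The weight \<open>exp (- K * (t - t0))\<close> with \<open>K\<close> exceeding the Lipschitz constant makes the
  Picard operator a contraction on the whole half-line at once.\<close>
lemma lipschitz_ode_global:
  fixes G :: "'a :: banach \<Rightarrow> 'a"
  assumes L: "\<And>u v. norm (G u - G v) \<le> L * norm (u - v)" and L0: "L > 0"
  shows "\<exists>z. z t0 = z0 \<and> (\<forall>t\<ge>t0. (z has_vector_derivative G (z t))
      (at t within {t0..}))"
proof -
  \<comment> \<open>The contraction factor will be \<open>L / K\<close>, here one half.\<close>
  define K where "K = 2 * L"
  have K: "K > 0" using L0 unfolding K_def by simp
  have G: "continuous_on UNIV G"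
    unfolding continuous_on_iff
  proof (intro ballI allI impI)
    fix u and e :: real assume e: "e > 0"
    have "dist (G v) (G u) < e" if "dist v u < e / L" for v
      using L[of v u] that L0 by (simp add: dist_norm field_simps)
    then show "\<exists>d>0. \<forall>v\<in>UNIV. dist v u < d \<longrightarrow> dist (G v) (G u) < e"
      using e L0 by (intro exI[of _ "e / L"]) auto
  qed
  \<comment> \<open>\<open>b\<close> stands for the solution multiplied by the decaying weight; the
    weight is undone before \<open>G\<close> is applied.\<close>
  define h where "h b s = G (exp (K * (s - t0)) *\<^sub>R apply_bcontfun b s)" for b s
  define J where "J b t = integral {t0..t} (h b)" for b t
  \<comment> \<open>Freezing the argument at \<open>t0\<close> on the left extends the image
    constantly by \<open>z0\<close>, so that it lives on the whole line as an element of
    \<open>bcontfun\<close>.\<close>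
  define P where "P b t = exp (- (K * (max t0 t - t0))) *\<^sub>R (z0 + J b (max t0 t))" for b t
  have h: "continuous_on UNIV (h b)" for b
    unfolding h_def by (intro continuous_on_compose2[OF G] continuous_intros) auto
  have Jd: "(J b has_vector_derivative h b t) (at t within {t0..})" if "t \<ge> t0" for b t
    unfolding J_def by (rule integral_has_vector_derivative_atLeast[OF h that])
  have Jc: "continuous_on {t0..} (J b)" for b
    unfolding continuous_on_eq_continuous_within using Jd has_vector_derivative_continuous by fastforce
  have "continuous_on UNIV (\<lambda>t. J b (max t0 t))" for b
    by (rule continuous_on_compose2[OF Jc, of UNIV "\<lambda>t. max t0 t"]) (auto intro!: continuous_intros)
  then have Pc: "continuous_on UNIV (P b)" for b
    unfolding P_def by (intro continuous_on_scaleR continuous_on_add continuous_intros)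
  have Pb: "norm (P b t) \<le> norm z0 + (norm (G 0) + L * norm b) / K" for b t
  proof -
    define s where "s = max t0 t"
    have s: "s \<ge> t0" unfolding s_def by simp
    have "norm (J b s) \<le> (norm (G 0) + L * norm b) / K * exp (K * (s - t0))" unfolding J_def
    proof (rule norm_integral_le_exp[OF h K _ s])
      fix r assume r: "r \<ge> t0"
      have e1: "exp (K * (r - t0)) \<ge> 1" using r K by simp
      have "norm (h b r) \<le> norm (G 0) + norm (h b r - G 0)" by (rule norm_triangle_sub)
      also have "\<dots> \<le> norm (G 0) + L * (exp (K * (r - t0)) * norm (apply_bcontfun b r))"
        using L[of "exp (K * (r - t0)) *\<^sub>R apply_bcontfun b r" 0] unfolding h_def by simp
      also have "\<dots> \<le> norm (G 0) * exp (K * (r - t0)) + L * (exp (K * (r - t0)) * norm b)"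
        using e1 L0 norm_bounded[of b r] by (intro add_mono mult_left_mono) (auto simp: mult_le_cancel_left1)
      finally show "norm (h b r) \<le> (norm (G 0) + L * norm b) * exp (K * (r - t0))"
          by (simp add: algebra_simps)
    qed (use L0 in simp)
    then have "exp (- (K * (s - t0))) * norm (J b s)
        \<le> exp (- (K * (s - t0))) * ((norm (G 0) + L * norm b) / K * exp (K * (s - t0)))"
      by (intro mult_left_mono) auto
    also have "\<dots> = (norm (G 0) + L * norm b) / K" by (simp add: exp_minus)
    finally have 1: "exp (- (K * (s - t0))) * norm (J b s) \<le> (norm (G 0) + L * norm b) / K" .
    have 2: "exp (- (K * (s - t0))) * norm z0 \<le> 1 * norm z0"
      using s K by (intro mult_right_mono) auto
    have "norm (P b t) \<le> exp (- (K * (s - t0))) * (norm z0 + norm (J b s))"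
      unfolding P_def s_def[symmetric] using norm_triangle_ineq[of z0 "J b s"] by simp
    then show ?thesis using 1 2 by (simp add: distrib_left)
  qed
  have Pin: "P b \<in> bcontfun" for b
    by (rule bcontfun_normI[OF Pc Pb])
  define T where "T b = Bcontfun (P b)" for b
  have T: "apply_bcontfun (T b) = P b" for b unfolding T_def by (simp add: Bcontfun_inverse Pin)
  have "dist (T b) (T b') \<le> 1/2 * dist b b'" for b b'
  proof (rule dist_bound)
    fix t
    define s where "s = max t0 t"
    have s: "s \<ge> t0" unfolding s_def by simp
    have int: "h b integrable_on {t0..s}" for b
      by (intro integrable_continuous_real continuous_on_subset[OF h]) auto
    have "norm (integral {t0..s} (\<lambda>r. h b r - h b' r)) \<le> L * dist b b' / K * exp (K * (s - t0))"
    proof (rule norm_integral_le_exp[OF _ K _ s])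
      show "continuous_on UNIV (\<lambda>r. h b r - h b' r)" by (intro continuous_intros h)
      show "0 \<le> L * dist b b'" using L0 by simp
      fix r
      have "norm (h b r - h b' r) \<le> L * norm (exp (K * (r - t0)) *\<^sub>R (apply_bcontfun b r
          - apply_bcontfun b' r))"
        using L unfolding h_def scaleR_right_diff_distrib by blast
      also have "\<dots> = L * (exp (K * (r - t0)) * dist (apply_bcontfun b r) (apply_bcontfun b'
          r))" by (simp add: dist_norm)
      also have "\<dots> \<le> L * (exp (K * (r - t0)) * dist b b')"
        using L0 dist_bounded[of b r b'] by (intro mult_left_mono) auto
      finally show "norm (h b r - h b' r) \<le> L * dist b b' * exp (K * (r - t0))" by (simp add: mult_ac)
    qed
    also have "integral {t0..s} (\<lambda>r. h b r - h b' r) = J b s - J b' s"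
      unfolding J_def by (rule integral_diff[OF int int])
    finally have J: "norm (J b s - J b' s) \<le> L * dist b b' / K * exp (K * (s - t0))" .
    have "dist (P b t) (P b' t) = exp (- (K * (s - t0))) * norm (J b s - J b' s)"
      unfolding P_def s_def[symmetric] dist_norm scaleR_right_diff_distrib[symmetric] by simp
    also have "\<dots> \<le> exp (- (K * (s - t0))) * (L * dist b b' / K * exp (K * (s - t0)))"
      by (intro mult_left_mono J) simp
    also have "\<dots> = L * dist b b' / K" by (simp add: exp_minus)
    also have "\<dots> = 1/2 * dist b b'" using L0 unfolding K_def by simp
    finally show "dist (apply_bcontfun (T b) t) (apply_bcontfun (T b') t) \<le> 1/2 * dist b b'" unfolding T .
  qed
  then have "\<exists>!b. T b = b"
    by (intro banach_fix_type[of "1/2" T]) auto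
  then obtain b where b: "T b = b" by auto
  define z where "z t = z0 + J b t" for t
  have zb: "exp (K * (t - t0)) *\<^sub>R apply_bcontfun b t = z t" if "t \<ge> t0" for t
  proof -
    have "apply_bcontfun b t = exp (- (K * (t - t0))) *\<^sub>R z t"
      using T[of b] that unfolding b P_def z_def by (simp add: max_def)
    then show ?thesis by (simp add: exp_minus)
  qed
  have "z t0 = z0" unfolding z_def J_def by simp
  moreover have "(z has_vector_derivative G (z t)) (at t within {t0..})" if "t \<ge> t0" for t
  proof -
    have "h b t = G (z t)" unfolding h_def zb[OF that] ..
    then show ?thesis using Jd[OF that, of b] unfolding z_def
      by (auto intro!: derivative_eq_intros)
  qed
  ultimately show ?thesis by blast
qed

instance bcontfun :: (metric_space, banach) banach ..

lemma bounded_linear_apply_bcontfun: "bounded_linear (\<lambda>f :: ('a :: metric_space, 'b ::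
    banach) bcontfun. apply_bcontfun f x)"
  by (rule bounded_linear_intro[of _ 1]) (auto simp: norm_bounded)

text \<open>The dimension being a term, the matrices of size \<open>n\<close> are not a Banach space type. They
  are embedded into the bounded continuous functions on the real line, as piecewise linear
  functions taking the value of entry \<open>(i,j)\<close> at \<open>i * n + j\<close>; composing with the
  projection to the Hermitian part extends the vector field to the whole space.\<close>
lemma hermitian_ode_global:
  assumes F: "\<And>A. hermitian_mat n A \<Longrightarrow> hermitian_mat n (F A)"
    and Lip: "\<And>A B. hermitian_mat n A \<Longrightarrow> hermitian_mat n B \<Longrightarrow>
      hs (F A - F B) (F A - F B) \<le> L\<^sup>2 * hs (A - B) (A - B)"
    and A0: "hermitian_mat n A0"
  shows "\<exists>c. c t0 = A0 \<and> (\<forall>t\<ge>t0. hermitian_mat n (c t)) \<and>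
      (\<forall>t\<ge>t0. \<forall>i<n. \<forall>j<n.
     ((\<lambda>s. c s $$ (i,j)) has_vector_derivative F (c t) $$ (i,j)) (at t within {t0..}))"
proof -
  define H :: "(real, complex) bcontfun \<Rightarrow> complex mat" where
    "H z = mat n n (\<lambda>(i,j). (apply_bcontfun z (real (i * n + j))
        + cnj (apply_bcontfun z (real (j * n + i)))) / 2)" for z
  have Hc[simp]: "H z \<in> carrier_mat n n" for z unfolding H_def by simp
  have Hh: "hermitian_mat n (H z)" for z
    unfolding hermitian_mat_def by (auto simp: H_def ctrans_def add.commute)
  define E :: "complex mat \<Rightarrow> real \<Rightarrow> complex" where
    "E w x = (\<Sum>k<n * n. complex_of_real (max 0 (1 - \<bar>x - real k\<bar>)) * w $$ (k div n,
        k mod n))" for w x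
  have ix: "k div n < n \<and> k mod n < n" if "k < n * n" for k
    using that by (cases n) (auto simp: less_mult_imp_div_less)
  have Ele: "cmod (E w x) \<le> real (n * n) * sqrt (hs w w)" if "w \<in> carrier_mat n n" for w x
  proof -
    have "cmod (complex_of_real (max 0 (1 - \<bar>x - real k\<bar>)) * w $$ (k div n, k mod n))
        \<le> 1 * sqrt (hs w w)" if k: "k < n * n" for k
      unfolding norm_mult
    proof (rule mult_mono)
      have "(cmod (w $$ (k div n, k mod n)))\<^sup>2 \<le> hs w w"
        using ix[OF k] by (intro entry_le_hs[OF \<open>w \<in> carrier_mat n n\<close>]) auto
      then show "cmod (w $$ (k div n, k mod n)) \<le> sqrt (hs w w)" by (simp add: real_le_rsqrt)
    qed auto
    then have "cmod (E w x) \<le> (\<Sum>k<n * n. 1 * sqrt (hs w w))"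
      unfolding E_def by (intro order_trans[OF norm_sum] sum_mono) auto
    then show ?thesis by simp
  qed
  have Ein: "E w \<in> bcontfun" if "w \<in> carrier_mat n n" for w
    by (rule bcontfun_normI[OF _ Ele[OF that]]) (unfold E_def, intro continuous_intros)
  have app: "apply_bcontfun (Bcontfun (E w)) = E w" if "w \<in> carrier_mat n n" for w
    using Ein[OF that] by (simp add: Bcontfun_inverse)
  have Eij: "E w (real (i * n + j)) = w $$ (i,j)" if "i < n" "j < n" for w i j
  proof -
    have "i * n + j < Suc i * n" using that by simp
    also have "\<dots> \<le> n * n" using that by (intro mult_right_mono) auto
    finally have l: "i * n + j < n * n" .
    \<comment> \<open>Distinct integers are at distance at least one, so each hat function vanishes
      at all other nodes.\<close>
    have t: "max 0 (1 - \<bar>real l - real k\<bar>) = (if k = l then 1 else 0)" for k l :: nat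
      by auto
    have "E w (real (i * n + j)) = (\<Sum>k<n * n. if k = i * n + j then w $$ (k div n, k mod n) else 0)"
      unfolding E_def t by (intro sum.cong) auto
    also have "\<dots> = w $$ (i,j)" using l that by simp
    finally show ?thesis .
  qed
  have Ediff: "E (A - B) x = E A x - E B x" if "A \<in> carrier_mat n n" "B \<in> carrier_mat n n" for A B x
    unfolding E_def sum_subtractf[symmetric] using ix that by (intro sum.cong) (auto simp: algebra_simps)
  define G where "G z = Bcontfun (E (F (H z)))" for z
  note Fc[simp] = hermitian_carrier[OF F[OF Hh]]
  \<comment> \<open>\<open>n * n\<close> counts the hats in \<open>E\<close>; the further
    \<open>n\<close> is the square root of the number of entries of \<open>H z - H z'\<close>.
    Adding \<open>1\<close> keeps the constant positive.\<close>
  have GL: "norm (G z - G z') \<le> (real (n * n) * \<bar>L\<bar> * n + 1) * norm (z - z')" for z z'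
  proof -
    have 1: "hs (H z - H z') (H z - H z') \<le> (real n * norm (z - z'))\<^sup>2"
    proof -
      have D: "H z - H z' \<in> carrier_mat n n" by simp
      have "cmod ((H z - H z') $$ (i,j)) \<le> norm (z - z')" if ij: "i < n" "j < n" for i j
      proof -
        let ?a = "apply_bcontfun (z - z') (real (i * n + j))"
            and ?b = "apply_bcontfun (z - z') (real (j * n + i))"
        have "(H z - H z') $$ (i,j) = (?a + cnj ?b) / 2"
          using ij by (simp add: H_def field_simps)
        then have "cmod ((H z - H z') $$ (i,j)) = cmod (?a + cnj ?b) / 2"
          by (simp only: norm_divide norm_numeral)
        also have "\<dots> \<le> (cmod ?a + cmod ?b) / 2"
          using norm_triangle_ineq[of ?a "cnj ?b"] unfolding complex_mod_cnj by simp
        also have "\<dots> \<le> norm (z - z')"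
          using norm_bounded[of "z - z'" "real (i * n
              + j)"] norm_bounded[of "z - z'" "real (j * n + i)"] by simp
        finally show ?thesis .
      qed
      then have "hs (H z - H z') (H z - H z') \<le> (\<Sum>i<n. \<Sum>j<n. (norm (z - z'))\<^sup>2)"
        unfolding hs_self_sum[OF D] by (intro sum_mono power_mono) auto
      also have "\<dots> = (real n * norm (z - z'))\<^sup>2" by (simp add: power2_eq_square)
      finally show ?thesis .
    qed
    have "norm (apply_bcontfun (G z - G z') k)
        \<le> (real (n * n) * \<bar>L\<bar> * n + 1) * norm (z - z')" for k
    proof -
      have D: "F (H z) - F (H z') \<in> carrier_mat n n" by simp
      have "apply_bcontfun (G z - G z') k = E (F (H z) - F (H z')) k"
        by (simp add: G_def app Ediff)
      then have "norm (apply_bcontfun (G z - G z') k)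
          \<le> real (n * n) * sqrt (hs (F (H z) - F (H z')) (F (H z) - F (H z')))"
        using Ele[OF D] by simp
      also have "\<dots> \<le> real (n * n) * sqrt (L\<^sup>2 * (real n * norm (z - z'))\<^sup>2)"
        using 1 by (intro mult_left_mono[of "sqrt _"] real_sqrt_le_mono order_trans[OF Lip[OF Hh
            Hh]] mult_left_mono) auto
      also have "\<dots> = real (n * n) * \<bar>L\<bar> * n * norm (z - z')" by (simp add: real_sqrt_mult)
      also have "\<dots> \<le> (real (n * n) * \<bar>L\<bar> * n + 1) * norm (z - z')"
          by (intro mult_right_mono) auto
      finally show ?thesis .
    qed
    then show ?thesis by (rule norm_bound)
  qed
  obtain z where z0: "z t0 = Bcontfun (E A0)"
    and z: "\<And>t. t \<ge> t0 \<Longrightarrow> (z has_vector_derivative G (z t)) (at t within {t0..})"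
    using lipschitz_ode_global[OF GL, of t0 "Bcontfun (E A0)"] by (auto simp: add_nonneg_pos)
  have "H (z t0) = A0"
  proof (rule eq_matI)
    fix i j assume "i < dim_row A0" "j < dim_col A0"
    then have ij: "i < n" "j < n" using hermitian_carrier[OF A0] by auto
    have "cnj (A0 $$ (j,i)) = A0 $$ (i,j)"
      using ctrans_index[OF hermitian_carrier[OF A0] ij] hermitian_ctrans[OF A0] by simp
    then show "H (z t0) $$ (i,j) = A0 $$ (i,j)"
      using ij unfolding z0 by (simp add: H_def app[OF hermitian_carrier[OF A0]] Eij del:
          of_nat_add of_nat_mult)
  qed (use hermitian_carrier[OF A0] in \<open>auto simp: H_def\<close>)
  moreover have "((\<lambda>s. H (z s) $$ (i,j)) has_vector_derivative F (H (z t)) $$ (i,j))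
      (at t within {t0..})"
    if t: "t \<ge> t0" and ij: "i < n" "j < n" for t i j
  proof -
    have d: "((\<lambda>s. apply_bcontfun (z s) (real (i * n
        + j))) has_vector_derivative F (H (z t)) $$ (i,j)) (at t within {t0..})"
      if "i < n" "j < n" for i j
      using bounded_linear.has_vector_derivative[OF bounded_linear_apply_bcontfun z[OF t], of "real
          (i * n + j)"]
      by (simp add: G_def app Eij that del: of_nat_add of_nat_mult)
    have DD: "((\<lambda>s. (apply_bcontfun (z s) (real (i * n + j))
        + cnj (apply_bcontfun (z s) (real (j * n + i)))) / 2) has_vector_derivative
      (F (H (z t)) $$ (i,j) + cnj (F (H (z t)) $$ (j,i))) / 2) (at t within {t0..})"
      by (rule bounded_linear.has_vector_derivative[OF bounded_linear_divide
          has_vector_derivative_add[OF d[OF ij]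
        bounded_linear.has_vector_derivative[OF bounded_linear_cnj d[OF ij(2,1)]]]])
    \<comment> \<open>\<open>F\<close> preserves Hermitian matrices, so averaging with the adjoint
      leaves the derivative equal to \<open>F (H (z t))\<close>.\<close>
    have CC: "cnj (F (H (z t)) $$ (j,i)) = F (H (z t)) $$ (i,j)"
      using ctrans_index[OF Fc ij] hermitian_ctrans[OF F[OF Hh]] by simp
    have HH: "H (z s) $$ (i,j) = (apply_bcontfun (z s) (real (i * n + j))
        + cnj (apply_bcontfun (z s) (real (j * n + i)))) / 2" for s
      using ij by (simp add: H_def)
    show ?thesis using DD unfolding HH CC by (simp del: of_nat_add of_nat_mult)
  qed
  ultimately show ?thesis using Hh by (intro exI[of _ "\<lambda>t. H (z t)"]) auto
qed


subsection \<open>Derivatives on a half-line\<close>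

lemma half_line_mvt:
  fixes f :: "real \<Rightarrow> real"
  assumes d: "\<And>t. t \<ge> a \<Longrightarrow> (f has_real_derivative f' t) (at t within {a..})"
    and st: "a \<le> s" "s < t"
  obtains r where "a \<le> r" "f t - f s = f' r * (t - s)"
proof -
  have "\<exists>r\<in>{s<..<t}. f t - f s = f' r * (t - s)"
  proof (rule mvt_simple[OF st(2)])
    fix r assume "s \<le> r" "r \<le> t"
    then have "(f has_real_derivative f' r) (at r within {s..t})"
      using st by (intro has_field_derivative_subset[OF d]) auto
    then show "(f has_derivative (\<lambda>h. f' r * h)) (at r within {s..t})"
      by (simp add: has_field_derivative_def)
  qed
  then obtain r where "r \<in> {s<..<t}" "f t - f s = f' r * (t - s)" by blast
  then show ?thesis using that[of r] st(1) by simp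
qed

lemma half_line_mono:
  fixes f :: "real \<Rightarrow> real"
  assumes d: "\<And>t. t \<ge> a \<Longrightarrow> (f has_real_derivative f' t) (at t within {a..})"
    and pos: "\<And>t. t \<ge> a \<Longrightarrow> 0 \<le> f' t" and st: "a \<le> s" "s \<le> t"
  shows "f s \<le> f t"
proof (cases "s < t")
  case True
  then obtain r where "a \<le> r" "f t - f s = f' r * (t - s)" using half_line_mvt[OF d st(1)] by blast
  moreover from this have "0 \<le> f' r * (t - s)" using st by (intro mult_nonneg_nonneg pos) auto
  ultimately show ?thesis by simp
qed (use st in simp)

lemma half_line_strict_mono:
  fixes f :: "real \<Rightarrow> real"
  assumes d: "\<And>t. t \<ge> a \<Longrightarrow> (f has_real_derivative f' t) (at t within {a..})"
    and pos: "\<And>t. t \<ge> a \<Longrightarrow> 0 < f' t" and st: "a \<le> s" "s < t"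
  shows "f s < f t"
proof -
  obtain r where "a \<le> r" "f t - f s = f' r * (t - s)" using half_line_mvt[OF d st] by blast
  moreover from this have "0 < f' r * (t - s)" using st by (intro mult_pos_pos pos) auto
  ultimately show ?thesis by simp
qed

text \<open>The integrating factor makes \<open>f t * exp (- C * (t - a))\<close> nondecreasing.
  \<open>C\<close> may have either sign; a negative one bounds how fast \<open>f\<close> can
  decay.\<close>

lemma gronwall_ge:
  fixes f :: "real \<Rightarrow> real"
  assumes d: "\<And>t. t \<ge> a \<Longrightarrow> (f has_real_derivative f' t) (at t within {a..})"
    and ge: "\<And>t. t \<ge> a \<Longrightarrow> C * f t \<le> f' t" and t: "a \<le> t"
  shows "f a * exp (C * (t - a)) \<le> f t"
proof -
  have "f a * exp (- C * (a - a)) \<le> f t * exp (- C * (t - a))"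
  proof (rule half_line_mono[where f = "\<lambda>t. f t * exp (- C * (t - a))"])
    fix r assume r: "r \<ge> a"
    show "((\<lambda>t. f t * exp (- C * (t - a))) has_real_derivative (f' r - C * f r) * exp (- C
        * (r - a))) (at r within {a..})"
      by (auto intro!: derivative_eq_intros d[OF r] simp: algebra_simps)
    show "0 \<le> (f' r - C * f r) * exp (- C * (r - a))" using ge[OF r] by simp
  qed (use t in auto)
  then have "f a * exp (C * (t - a)) \<le> f t * exp (- C * (t - a)) * exp (C * (t - a))"
    by (intro mult_right_mono) auto
  then show ?thesis by (simp add: mult.assoc exp_add[symmetric])
qed

lemma gronwall_le:
  fixes f :: "real \<Rightarrow> real"
  assumes d: "\<And>t. t \<ge> a \<Longrightarrow> (f has_real_derivative f' t) (at t within {a..})"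
    and le: "\<And>t. t \<ge> a \<Longrightarrow> f' t \<le> C * f t" and t: "a \<le> t"
  shows "f t \<le> f a * exp (C * (t - a))"
  using gronwall_ge[of a "\<lambda>t. - f t" "\<lambda>t. - f' t" C t] d le t
  by (auto intro!: derivative_eq_intros)

text \<open>\<open>k\<close> plays the linearization and \<open>r\<close> the remainder. This
  replaces a chain rule for traces of functions of matrices.\<close>

lemma has_real_derivative_squeeze:
  fixes h k r :: "real \<Rightarrow> real"
  assumes k: "(k has_real_derivative D) (at t within S)" and r: "(r has_real_derivative 0) (at t within S)"
    and rt: "r t = 0" and le: "\<And>s. s \<in> S \<Longrightarrow>
        \<bar>h s - h t - (k s - k t)\<bar> \<le> r s"
  shows "(h has_real_derivative D) (at t within S)"
proof -
  have "((\<lambda>s. (h s - h t) / (s - t) - (k s - k t) / (s - t)) \<longlongrightarrow> 0) (at t within S)"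
  proof (rule Lim_null_comparison)
    show "((\<lambda>s. \<bar>(r s - r t) / (s - t)\<bar>) \<longlongrightarrow> 0) (at t within S)"
      using r unfolding has_field_derivative_iff by (rule tendsto_rabs_zero)
    show "\<forall>\<^sub>F s in at t within S. norm ((h s - h t) / (s - t) - (k s - k t) / (s -
        t)) \<le> \<bar>(r s - r t) / (s - t)\<bar>"
    proof (rule eventually_mono)
      show "\<forall>\<^sub>F s in at t within S. s \<in> S" by (simp add: eventually_at_filter)
      fix s assume "s \<in> S"
      from le[OF this] have "\<bar>h s - h t - (k s - k t)\<bar> / \<bar>s - t\<bar>
          \<le> \<bar>r s\<bar> / \<bar>s - t\<bar>"
        by (intro divide_right_mono) auto
      then show "norm ((h s - h t) / (s - t) - (k s - k t) / (s - t)) \<le> \<bar>(r s - r t) / (s - t)\<bar>"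
        by (simp add: rt abs_divide diff_divide_distrib[symmetric])
    qed
  qed
  from tendsto_add[OF this k[unfolded has_field_derivative_iff]]
  show ?thesis unfolding has_field_derivative_iff by simp
qed

subsection \<open>Derivatives of spectral functions\<close>

definition mat_deriv :: "nat \<Rightarrow> (real \<Rightarrow> complex mat) \<Rightarrow> complex
    mat \<Rightarrow> real \<Rightarrow> real set \<Rightarrow> bool" where
  "mat_deriv n c D t S \<longleftrightarrow> (\<forall>i<n. \<forall>j<n. ((\<lambda>s. c s $$
      (i,j)) has_vector_derivative D $$ (i,j)) (at t within S))"

lemma mat_deriv_minus:
  assumes d: "mat_deriv n c D t S" and d': "mat_deriv n c' D' t S" and t: "t \<in> S"
    and c': "\<And>s. s \<in> S \<Longrightarrow> c' s \<in> carrier_mat n n" and D': "D' \<in> carrier_mat n n"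
  shows "mat_deriv n (\<lambda>s. c s - c' s) (D - D') t S"
  unfolding mat_deriv_def
proof (intro allI impI)
  fix i j assume ij: "i < n" "j < n"
  have "((\<lambda>s. c s $$ (i,j) - c' s $$ (i,j)) has_vector_derivative D $$ (i,j) - D' $$ (i,j))
      (at t within S)"
    using d d' ij unfolding mat_deriv_def by (intro has_vector_derivative_diff) auto
  then have "((\<lambda>s. c s $$ (i,j) - c' s $$ (i,j)) has_vector_derivative (D - D') $$ (i,j))
      (at t within S)"
    using ij carrier_matD[OF D'] by simp
  then show "((\<lambda>s. (c s - c' s) $$ (i,j)) has_vector_derivative (D - D') $$ (i,j)) (at t within S)"
    by (rule has_vector_derivative_transform[OF t, rotated]) (use ij carrier_matD[OF c'] in simp)
qed

lemma mat_deriv_minus_const: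
  assumes d: "mat_deriv n c D t S" and A: "A \<in> carrier_mat n n"
  shows "mat_deriv n (\<lambda>s. c s - A) D t S"
  unfolding mat_deriv_def
proof (intro allI impI)
  fix i j assume ij: "i < n" "j < n"
  have "((\<lambda>s. c s $$ (i,j) - A $$ (i,j)) has_vector_derivative D $$ (i,j) - 0) (at t within S)"
    using d ij unfolding mat_deriv_def by (intro has_vector_derivative_diff has_vector_derivative_const) auto
  then show "((\<lambda>s. (c s - A) $$ (i,j)) has_vector_derivative D $$ (i,j)) (at t within S)"
    using ij carrier_matD[OF A] by simp
qed

lemma hs_has_derivative:
  assumes c: "\<And>s. s \<in> S \<Longrightarrow> c s \<in> carrier_mat n n"
      and t: "t \<in> S" and D: "D \<in> carrier_mat n n"
    and A: "A \<in> carrier_mat n n" and d: "mat_deriv n c D t S"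
  shows "((\<lambda>s. hs A (c s)) has_real_derivative hs A D) (at t within S)"
proof -
  have "((\<lambda>s. \<Sum>i<n. \<Sum>j<n. Re (cnj (A $$ (i,j)) * c s $$ (i,j))) has_vector_derivative
      (\<Sum>i<n. \<Sum>j<n. Re (cnj (A $$ (i,j)) * D $$ (i,j)))) (at t within S)"
  proof (intro has_vector_derivative_sum)
    fix i j assume "i \<in> {..<n}" "j \<in> {..<n}"
    then have "((\<lambda>s. c s $$ (i,j)) has_vector_derivative D $$ (i,j)) (at t within S)"
      using d unfolding mat_deriv_def by simp
    then show "((\<lambda>s. Re (cnj (A $$ (i,j)) * c s $$ (i,j))) has_vector_derivative Re (cnj (A
        $$ (i,j)) * D $$ (i,j))) (at t within S)"
      by (rule bounded_linear.has_vector_derivative[OF bounded_linear_Re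
          bounded_linear.has_vector_derivative[OF bounded_linear_mult_right]])
  qed
  then have "((\<lambda>s. hs A (c s)) has_vector_derivative hs A D) (at t within S)"
    unfolding hs_sum[OF A D, symmetric]
    by (rule has_vector_derivative_transform[OF t, rotated]) (use hs_sum[OF A c] in blast)
  then show ?thesis by (simp add: has_real_derivative_iff_has_vector_derivative)
qed

lemma hs_self_has_derivative:
  assumes c: "\<And>s. s \<in> S \<Longrightarrow> c s \<in> carrier_mat n n"
      and t: "t \<in> S" and D: "D \<in> carrier_mat n n"
    and d: "mat_deriv n c D t S"
  shows "((\<lambda>s. hs (c s) (c s)) has_real_derivative 2 * hs (c t) D) (at t within S)"
proof -
  have "((\<lambda>s. \<Sum>i<n. \<Sum>j<n. Re (cnj (c s $$ (i,j)) * c s $$ (i,j))) has_vector_derivative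
      (\<Sum>i<n. \<Sum>j<n. 2 * Re (cnj (c t $$ (i,j)) * D $$ (i,j)))) (at t within S)"
  proof (intro has_vector_derivative_sum)
    fix i j assume "i \<in> {..<n}" "j \<in> {..<n}"
    then have e: "((\<lambda>s. c s $$ (i,j)) has_vector_derivative D $$ (i,j)) (at t within S)"
      using d unfolding mat_deriv_def by simp
    have "((\<lambda>s. Re (cnj (c s $$ (i,j)) * c s $$ (i,j))) has_vector_derivative
      Re (cnj (c t $$ (i,j)) * D $$ (i,j) + cnj (D $$ (i,j)) * c t $$ (i,j))) (at t within S)"
      by (rule bounded_linear.has_vector_derivative[OF bounded_linear_Re has_vector_derivative_mult[OF
        bounded_linear.has_vector_derivative[OF bounded_linear_cnj e] e]])
    then show "((\<lambda>s. Re (cnj (c s $$ (i,j)) * c s $$ (i,j))) has_vector_derivative 2 * Re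
        (cnj (c t $$ (i,j)) * D $$ (i,j))) (at t within S)"
      by (rule back_subst[where P = "\<lambda>v. (_ has_vector_derivative v) _"]) (simp add: algebra_simps)
  qed
  moreover have "(\<Sum>i<n. \<Sum>j<n. 2 * Re (cnj (c t $$ (i,j)) * D $$ (i,j))) = 2 * hs (c t) D"
    unfolding hs_sum[OF c[OF t] D] sum_distrib_left ..
  ultimately have "((\<lambda>s. \<Sum>i<n. \<Sum>j<n. Re (cnj (c s $$ (i,j)) * c s $$ (i,j)))
      has_vector_derivative 2 * hs (c t) D) (at t within S)"
    by simp
  then have "((\<lambda>s. hs (c s) (c s)) has_vector_derivative 2 * hs (c t) D) (at t within S)"
    by (rule has_vector_derivative_transform[OF t, rotated]) (use hs_sum[OF c c] in blast)
  then show ?thesis by (simp add: has_real_derivative_iff_has_vector_derivative)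
qed

section \<open>Localization of the spectrum, and the derivative of a trace function\<close>

definition spec_in :: "nat \<Rightarrow> real set \<Rightarrow> complex mat \<Rightarrow> bool" where
  "spec_in n S A \<longleftrightarrow> (\<exists>U d. has_spectral n A U d \<and> (\<forall>i<n. d i \<in> S))"

lemma spec_in_spectral:
  assumes "has_spectral n A U d"
  shows "spec_in n S A \<longleftrightarrow> (\<forall>i<n. d i \<in> S)"
proof
  assume "spec_in n S A"
  then obtain V e where V: "has_spectral n A V e" and e: "\<forall>i<n. e i \<in> S"
      unfolding spec_in_def by blast
  show "\<forall>i<n. d i \<in> S"
  proof (intro allI impI)
    fix i assume "i < n"
    then have "eigenvalue A (complex_of_real (d i))" using eigenvalue_spectral[OF assms] by blast
    then obtain j where "j < n" "complex_of_real (d i) = complex_of_real (e j)"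
      unfolding eigenvalue_spectral[OF V] by blast
    then show "d i \<in> S" using e by simp
  qed
qed (use assms in \<open>auto simp: spec_in_def\<close>)

lemma spec_in_hermitian: "spec_in n S A \<Longrightarrow> hermitian_mat n A"
  unfolding spec_in_def using has_spectral_hermitian by blast

lemma spec_in_mono: "spec_in n S A \<Longrightarrow> S \<subseteq> T \<Longrightarrow> spec_in n T A"
  unfolding spec_in_def by blast

lemma spec_in_UNIV: "hermitian_mat n A \<Longrightarrow> spec_in n UNIV A"
  unfolding spec_in_def using hermitian_spectralE by (metis UNIV_I)

lemma strictly_pos_iff_spec_in: "strictly_pos_mat n A \<longleftrightarrow> spec_in n {0<..} A"
proof
  assume "strictly_pos_mat n A"
  moreover from this obtain U d where "has_spectral n A U d"
    unfolding strictly_pos_mat_def using hermitian_spectralE by blast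
  ultimately show "spec_in n {0<..} A" using strictly_pos_spectral spec_in_spectral by fastforce
next
  assume "spec_in n {0<..} A"
  then show "strictly_pos_mat n A" unfolding spec_in_def using strictly_pos_spectral by fastforce
qed

lemma trf_has_derivative:
  assumes spec: "\<And>s. s \<in> S \<Longrightarrow> spec_in n I (c s)" and t: "t \<in> S"
      and D: "D \<in> carrier_mat n n"
    and d: "mat_deriv n c D t S"
    and g: "\<And>a b. a \<in> I \<Longrightarrow> b \<in> I \<Longrightarrow>
        \<bar>g a - g b - g' b * (a - b)\<bar> \<le> K * (a - b)\<^sup>2"
  shows "((\<lambda>s. trf n g (c s)) has_real_derivative hs (fcalc n g' (c t)) D) (at t within S)"
proof -
  have c: "c s \<in> carrier_mat n n" if "s \<in> S" for s
    using spec_in_hermitian[OF spec[OF that]] hermitian_carrier by blast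
  have G: "fcalc n g' (c t) \<in> carrier_mat n n"
    by (rule herm_fun_calc_carrier[OF spec_in_hermitian[OF spec[OF t]]])
  have "((\<lambda>s. hs (c s - c t) (c s - c t)) has_real_derivative 2 * hs (c t - c t) D) (at t within S)"
    using c c[OF t] t D by (intro hs_self_has_derivative[where n=n] mat_deriv_minus_const d) auto
  moreover have "hs (c t - c t) D = 0" using hs_minus_left[OF c[OF t] c[OF t] D] by simp
  ultimately have "((\<lambda>s. K * hs (c s - c t) (c s - c t)) has_real_derivative 0) (at t within S)"
    by (auto intro!: derivative_eq_intros)
  note r = this
  have k: "((\<lambda>s. hs (fcalc n g' (c t)) (c s)) has_real_derivative hs (fcalc n g' (c t)) D)
      (at t within S)"
    using c by (intro hs_has_derivative[OF _ t D G d])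
  show ?thesis
  proof (rule has_real_derivative_squeeze[OF k r])
    show "K * hs (c t - c t) (c t - c t) = 0"
      using hs_minus_left[OF c[OF t] c[OF t], of "c t - c t"] c[OF t] by simp
    fix s assume s: "s \<in> S"
    obtain U a where A: "has_spectral n (c s) U a" "\<forall>i<n. a i \<in> I"
        using spec[OF s] unfolding spec_in_def by blast
    obtain V b where B: "has_spectral n (c t) V b" "\<forall>i<n. b i \<in> I"
        using spec[OF t] unfolding spec_in_def by blast
    have "\<bar>trf n g (c s) - trf n g (c t) - hs (fcalc n g' (c t)) (c s - c t)\<bar>
        \<le> K * hs (c s - c t) (c s - c t)"
      by (rule trf_first_order[OF A(1) B(1)]) (use A(2) B(2) g in auto)
    then show "\<bar>trf n g (c s) - trf n g (c t) - (hs (fcalc n g' (c t)) (c s) - hs (fcalc n g'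
        (c t)) (c t))\<bar>
      \<le> K * hs (c s - c t) (c s - c t)"
      using hs_minus_right[OF G c[OF s] c[OF t]] by simp
  qed
qed

subsection \<open>Scalar estimates for the logarithm\<close>

lemma ln_diff_bounds:
  fixes a b :: real
  assumes "0 < b" "b \<le> a"
  shows "(a - b) / a \<le> ln a - ln b" "ln a - ln b \<le> (a - b) / b"
proof -
  have "ln (a / b) \<le> a / b - 1" using assms by (intro ln_le_minus_one) auto
  then show "ln a - ln b \<le> (a - b) / b" using assms by (simp add: ln_div diff_divide_distrib)
  have "ln (b / a) \<le> b / a - 1" using assms by (intro ln_le_minus_one) auto
  then show "(a - b) / a \<le> ln a - ln b" using assms by (simp add: ln_div diff_divide_distrib)
qed

lemma ln_Lipschitz:
  fixes a b e :: real
  assumes "0 < e" "e \<le> a" "e \<le> b"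
  shows "\<bar>ln a - ln b\<bar> \<le> \<bar>a - b\<bar> / e"
proof -
  have *: "\<bar>ln a - ln b\<bar> \<le> \<bar>a - b\<bar> / e" if "e \<le> b" "b \<le> a" for a b
  proof -
    have "ln a - ln b \<le> (a - b) / b" using ln_diff_bounds(2)[of b a] that assms(1) by simp
    also have "\<dots> \<le> (a - b) / e" using that assms(1) by (intro divide_left_mono) auto
    finally show ?thesis using that assms(1) by simp
  qed
  show ?thesis using *[of a b] *[of b a] assms by (cases "b \<le> a") (auto simp: abs_minus_commute)
qed

text \<open>On \<open>(0, M]\<close> the slopes of \<open>ln\<close> are at least
  \<open>1 / M\<close>; this drives the exponential decay.\<close>

lemma ln_dissipation_lower:
  fixes a b M :: real
  assumes "0 < a" "0 < b" "a \<le> M" "b \<le> M"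
  shows "(a - b) * (a - b) \<le> M * ((a - b) * (ln a - ln b))"
proof -
  have *: "(a - b) * (a - b) \<le> M * ((a - b) * (ln a - ln b))" if "0 < b" "b \<le> a" "a \<le> M" for a b
  proof -
    have "(a - b) / M \<le> (a - b) / a" using that by (intro divide_left_mono) auto
    also have "\<dots> \<le> ln a - ln b" using ln_diff_bounds(1) that by simp
    finally have "a - b \<le> M * (ln a - ln b)" using that by (simp add: field_simps)
    then have "(a - b) * (a - b) \<le> (a - b) * (M * (ln a - ln b))" using that by (intro mult_left_mono) auto
    then show ?thesis by (simp add: mult_ac)
  qed
  show ?thesis using *[of a b] *[of b a] assms by (cases "b \<le> a") (auto simp: algebra_simps)
qed

text \<open>Above \<open>e\<close> the slopes of \<open>ln\<close> are at most \<open>1 / e\<close>;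
  this limits the speed of the decay.\<close>

lemma ln_dissipation_upper:
  fixes a b e :: real
  assumes "0 < e" "e \<le> a" "e \<le> b"
  shows "e * ((a - b) * (ln a - ln b)) \<le> (a - b) * (a - b)"
proof -
  have "e * \<bar>ln a - ln b\<bar> \<le> \<bar>a - b\<bar>" using ln_Lipschitz[OF assms] assms
      by (simp add: field_simps)
  then have "\<bar>a - b\<bar> * (e * \<bar>ln a - ln b\<bar>)
      \<le> \<bar>a - b\<bar> * \<bar>a - b\<bar>" by (intro mult_left_mono) auto
  moreover have "(a - b) * (ln a - ln b) \<le> \<bar>a - b\<bar> * \<bar>ln a - ln b\<bar>"
      by (simp add: abs_mult[symmetric])
  then have "e * ((a - b) * (ln a - ln b))
      \<le> e * (\<bar>a - b\<bar> * \<bar>ln a - ln b\<bar>)" using assms by (intro mult_left_mono) auto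
  ultimately show ?thesis by (simp add: mult_ac abs_mult[symmetric])
qed

lemma ln_first_order:
  fixes a b e :: real
  assumes "0 < e" "e \<le> a" "e \<le> b"
  shows "\<bar>ln a - ln b - 1 / b * (a - b)\<bar> \<le> 1 / e\<^sup>2 * (a - b)\<^sup>2"
proof -
  have ab: "0 < a" "0 < b" using assms by auto
  have 1: "ln a - ln b \<le> (a - b) / b"
    using ln_le_minus_one[of "a / b"] ab by (simp add: ln_div diff_divide_distrib)
  have 2: "(a - b) / a \<le> ln a - ln b"
    using ln_le_minus_one[of "b / a"] ab by (simp add: ln_div diff_divide_distrib)
  have "(a - b) / b - (a - b) / a = (a - b)\<^sup>2 / (a * b)" using ab
      by (simp add: field_simps power2_eq_square)
  also have "\<dots> \<le> (a - b)\<^sup>2 / (e * e)" using assms ab by (intro divide_left_mono mult_mono) auto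
  finally show ?thesis using 1 2 by (simp add: power2_eq_square)
qed

text \<open>The derivative of the squared hinge is Lipschitz with constant 2, which gives the
  remainder constant 1 even across the kink of the derivative at \<open>e\<close>.\<close>

lemma hinge_square_first_order:
  fixes a b e :: real
  shows "\<bar>(max 0 (e - a))\<^sup>2 - (max 0 (e - b))\<^sup>2 - (- 2 * max 0 (e - b)) * (a -
      b)\<bar> \<le> 1 * (a - b)\<^sup>2"
proof -
  consider "a \<le> e" "b \<le> e" | "a > e" "b > e" | "a \<le> e" "b > e" | "a > e" "b \<le> e" by linarith
  then show ?thesis
  proof cases
    case 1
    then have "(max 0 (e - a))\<^sup>2 - (max 0 (e - b))\<^sup>2 - (- 2 * max 0 (e - b)) * (a - b)
        = (a - b)\<^sup>2"
      by (simp add: power2_eq_square algebra_simps)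
    then show ?thesis by simp
  next
    case 2 then show ?thesis by simp
  next
    case 3
    then have "(e - a)\<^sup>2 \<le> (b - a)\<^sup>2" by (intro power_mono) auto
    then show ?thesis using 3 by (simp add: power2_commute)
  next
    case 4
    \<comment> \<open>The expression inside the absolute value is \<open>2 * q * p\<close> minus the
      square of \<open>q\<close>. It lies between \<open>0\<close> and the square of
      \<open>p\<close>, because \<open>0 \<le> q \<le> p\<close>.\<close>
    define q p where "q = e - b" and "p = a - b"
    have qp: "0 \<le> q" "q \<le> p" using 4 unfolding q_def p_def by auto
    have "0 \<le> q * (p - q)" "0 \<le> q * p" using qp by auto
    then have "0 \<le> 2 * q * p - q\<^sup>2" by (simp add: power2_eq_square algebra_simps)
    moreover have "2 * q * p - q\<^sup>2 \<le> p\<^sup>2" using zero_le_power2[of "p - q"]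
        by (simp add: power2_eq_square algebra_simps)
    moreover have "(max 0 (e - a))\<^sup>2 - (max 0 (e - b))\<^sup>2 - (- 2 * max 0 (e - b)) * (a -
        b) = 2 * q * p - q\<^sup>2"
      using 4 unfolding q_def p_def by (simp add: algebra_simps)
    ultimately show ?thesis unfolding p_def by simp
  qed
qed


subsection \<open>The flow of a scalar function\<close>

locale hermitian_pair =
  fixes n :: nat and x y :: "complex mat"
  assumes x: "hermitian_mat n x" and y: "hermitian_mat n y"
begin

abbreviation lap :: "complex mat \<Rightarrow> complex mat" where
  "lap \<equiv> nc_laplacian x y"

lemma x_carrier: "x \<in> carrier_mat n n" and y_carrier: "y \<in> carrier_mat n n"
  using hermitian_carrier x y by auto

lemma lap_carrier[simp]: "a \<in> carrier_mat n n \<Longrightarrow> lap a \<in> carrier_mat n n"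
  using x_carrier y_carrier by simp

text \<open>A general \<open>f\<close> treats the logarithm and its truncation alike;
  \<open>I\<close> records what is known so far about the spectra and shrinks as bounds are
  proved.\<close>

definition flow :: "(real \<Rightarrow> real) \<Rightarrow> real set \<Rightarrow> real
    \<Rightarrow> (real \<Rightarrow> complex mat) \<Rightarrow> bool" where
  "flow f I t0 c \<longleftrightarrow> (\<forall>t\<ge>t0. spec_in n I (c t) \<and> mat_deriv n c
      (- lap (fcalc n f (c t))) t {t0..})"

lemma flow_spec: "flow f I t0 c \<Longrightarrow> t \<ge> t0 \<Longrightarrow> spec_in n I (c t)"
  unfolding flow_def by simp

lemma flow_hermitian: "flow f I t0 c \<Longrightarrow> t \<ge> t0 \<Longrightarrow> hermitian_mat n (c t)"
  using flow_spec spec_in_hermitian by blast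

lemma flow_carrier: "flow f I t0 c \<Longrightarrow> t \<ge> t0 \<Longrightarrow> c t \<in> carrier_mat n n"
  using flow_hermitian hermitian_carrier by blast

lemma flow_deriv: "flow f I t0 c \<Longrightarrow> t \<ge> t0 \<Longrightarrow>
    mat_deriv n c (- lap (fcalc n f (c t))) t {t0..}"
  unfolding flow_def by simp

lemma flow_fcalc_carrier: "flow f I t0 c \<Longrightarrow> t \<ge> t0 \<Longrightarrow>
    fcalc n g (c t) \<in> carrier_mat n n"
  using flow_hermitian herm_fun_calc_carrier by blast

lemma flow_trf_deriv:
  assumes fl: "flow f I t0 c" and t: "t \<ge> t0"
    and g: "\<And>a b. a \<in> I \<Longrightarrow> b \<in> I \<Longrightarrow>
        \<bar>g a - g b - g' b * (a - b)\<bar> \<le> K * (a - b)\<^sup>2"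
  shows "((\<lambda>s. trf n g (c s)) has_real_derivative - hs (fcalc n g' (c t)) (lap (fcalc n f
      (c t)))) (at t within {t0..})"
proof -
  note c = flow_fcalc_carrier[OF fl t]
  have "((\<lambda>s. trf n g (c s)) has_real_derivative hs (fcalc n g' (c t)) (- lap (fcalc n f (c
      t)))) (at t within {t0..})"
    by (rule trf_has_derivative[where I = I and K = K])
      (use flow_spec[OF fl] t flow_deriv[OF fl t] g c in auto)
  then show ?thesis using hs_uminus_right[OF c lap_carrier[OF c]] by simp
qed

lemma hs_lap_mono:
  assumes A: "spec_in n I A"
    and le: "\<And>a b. a \<in> I \<Longrightarrow> b \<in> I \<Longrightarrow>
      k * ((f a - f b) * (g a - g b)) \<le> k' * ((f' a - f' b) * (g' a - g' b))"
  shows "k * hs (fcalc n f A) (lap (fcalc n g A)) \<le> k' * hs (fcalc n f' A) (lap (fcalc n g' A))"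
proof -
  obtain U d where "has_spectral n A U d" "\<forall>i<n. d i \<in> I" using A unfolding spec_in_def by blast
  then show ?thesis using le by (intro hs_laplacian_fcalc_mono[OF x y]) auto
qed

text \<open>For convex \<open>g\<close> and monotone \<open>f\<close> the function \<open>trf n g\<close> decreases along the flow of \<open>f\<close>;
  with \<open>g s = (max 0 (e - s))\<^sup>2\<close> this is a minimum principle for the spectrum.\<close>
lemma flow_spec_ge:
  assumes fl: "flow f I t0 c" and mono: "mono_on I f" and init: "spec_in n {e..} (c t0)" and t: "t \<ge> t0"
  shows "spec_in n {e..} (c t)"
proof -
  let ?g = "\<lambda>s. (max 0 (e - s))\<^sup>2" and ?g' = "\<lambda>s. - 2 * max 0 (e - s)"
  have d: "((\<lambda>s. trf n ?g (c s)) has_real_derivative - hs (fcalc n ?g' (c r)) (lap (fcalc n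
      f (c r)))) (at r within {t0..})"
    if "r \<ge> t0" for r
    by (rule flow_trf_deriv[OF fl that, of ?g ?g' 1]) (rule hinge_square_first_order)
  have "0 \<le> hs (fcalc n ?g' (c r)) (lap (fcalc n f (c r)))" if r: "r \<ge> t0" for r
  proof -
    \<comment> \<open>With the factor \<open>0\<close> the comparison lemma yields nonnegativity:
      \<open>?g'\<close> increases by convexity of the squared hinge, and so does
      \<open>f\<close>.\<close>
    have "0 * hs (fcalc n (\<lambda>s. s) (c r)) (lap (fcalc n (\<lambda>s. s) (c r)))
        \<le> 1 * hs (fcalc n ?g' (c r)) (lap (fcalc n f (c r)))"
    proof (rule hs_lap_mono[OF flow_spec[OF fl r]])
      fix a b assume ab: "a \<in> I" "b \<in> I"
      have *: "0 \<le> (?g' a - ?g' b) * (f a - f b)" if "a \<le> b" "a \<in> I" "b \<in> I" for a b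
        using monotone_onD[OF mono that(2,3,1)] that(1) by (intro mult_nonpos_nonpos) auto
      have "(?g' a - ?g' b) * (f a - f b) = (?g' b - ?g' a) * (f b - f a)" by (simp add: algebra_simps)
      then have "0 \<le> (?g' a - ?g' b) * (f a - f b)" using *[of a b] *[of b a] ab by (metis linear)
      then show "0 * ((a - b) * (a - b)) \<le> 1 * ((?g' a - ?g' b) * (f a - f b))" by simp
    qed
    then show ?thesis by simp
  qed
  then have le: "trf n ?g (c t) \<le> trf n ?g (c t0)"
    using half_line_mono[where f = "\<lambda>s. - trf n ?g (c s)" and a = t0 and s = t0
        and t = t, OF DERIV_minus[OF d]] t by simp
  obtain U d where s0: "has_spectral n (c t0) U d" "\<forall>i<n. d i \<in> {e..}"
      using init unfolding spec_in_def by blast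
  have 0: "trf n ?g (c t0) = 0" unfolding trf_spectral[OF s0(1)] using s0(2) by (intro sum.neutral) auto
  obtain V d' where s: "has_spectral n (c t) V d'" using flow_hermitian[OF fl t] hermitian_spectralE by blast
  have "(\<Sum>i<n. ?g (d' i)) \<le> 0" using le unfolding 0 trf_spectral[OF s] .
  moreover have "(\<Sum>i<n. ?g (d' i)) \<ge> 0" by (intro sum_nonneg) auto
  ultimately have "(\<Sum>i<n. ?g (d' i)) = 0" by linarith
  then have "\<forall>i\<in>{..<n}. ?g (d' i) = 0" by (subst (asm) sum_nonneg_eq_0_iff) auto
  then have "max 0 (e - d' i) = 0" if "i < n" for i using that by simp
  then show ?thesis unfolding spec_in_spectral[OF s] by (fastforce simp: max_def split: if_splits)
qed

lemma mtrace_trf: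
  assumes "hermitian_mat n A"
  shows "mtrace A = complex_of_real (trf n (\<lambda>s. s) A)"
proof -
  obtain U d where s: "has_spectral n A U d" using assms hermitian_spectralE by blast
  show ?thesis unfolding mtrace_spectral[OF s] trf_spectral[OF s] ..
qed

lemma flow_mtrace:
  assumes fl: "flow f I t0 c" and t: "t \<ge> t0"
  shows "mtrace (c t) = mtrace (c t0)"
proof -
  have d: "((\<lambda>s. trf n (\<lambda>s. s) (c s)) has_real_derivative 0)
      (at r within {t0..})" if r: "r \<ge> t0" for r
  proof -
    note c = flow_fcalc_carrier[OF fl r]
    have "fcalc n (\<lambda>s. 1) (c r) = 1\<^sub>m n"
      unfolding fcalc_const[OF flow_hermitian[OF fl r]] by (rule eq_matI) auto
    \<comment> \<open>Pairing with the identity is taking the trace, and commutators have trace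
      zero.\<close>
    then have "hs (fcalc n (\<lambda>s. 1) (c r)) (lap (fcalc n f (c r))) = 0"
      unfolding hs_def using mtrace_nc_laplacian[OF x_carrier y_carrier c] lap_carrier[OF c] by simp
    then show ?thesis using flow_trf_deriv[OF fl r, of "\<lambda>s. s" "\<lambda>s. 1" 0] by simp
  qed
  have "trf n (\<lambda>s. s) (c t0) \<le> trf n (\<lambda>s. s) (c t)"
    by (rule half_line_mono[OF d]) (use t in auto)
  moreover have "- trf n (\<lambda>s. s) (c t0) \<le> - trf n (\<lambda>s. s) (c t)"
    by (rule half_line_mono[OF DERIV_minus[OF d]]) (use t in auto)
  ultimately show ?thesis using mtrace_trf flow_hermitian[OF fl] t by simp
qed

section \<open>The distance to the scalar matrices\<close>

definition mean_part :: "complex mat \<Rightarrow> complex mat" where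
  "mean_part A = (mtrace A / of_nat n) \<cdot>\<^sub>m 1\<^sub>m n"

lemma mean_part_carrier[simp]: "mean_part A \<in> carrier_mat n n"
  unfolding mean_part_def by simp

lemma commut_mean_part:
  "Y \<in> carrier_mat n n \<Longrightarrow> A \<in> carrier_mat n n \<Longrightarrow>
      commut Y (A - mean_part B) = commut Y A"
  unfolding mean_part_def
  by (simp add: commut_minus[of _ n] commut_scalar[of _ n]) (intro eq_matI, auto simp: commut_def)

lemma hs_lap_mean_part:
  assumes "A \<in> carrier_mat n n" "B \<in> carrier_mat n n"
  shows "hs (A - mean_part C) (lap B) = hs A (lap B)"
  using assms by (simp add: hs_nc_laplacian[OF x y] commut_mean_part x_carrier y_carrier)

text \<open>For Hermitian \<open>A\<close> this is the sum of the squared deviations of the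
  eigenvalues from their mean.\<close>

definition variance :: "complex mat \<Rightarrow> real" where
  "variance A = hs (A - mean_part A) (A - mean_part A)"

lemma variance_nonneg: "variance A \<ge> 0"
  unfolding variance_def by (rule hs_self_nonneg[of _ n]) simp

text \<open>The converse of the spectral gap: the Dirichlet form is bounded and does not see
  scalars.\<close>

lemma hs_lap_le_variance:
  assumes A: "A \<in> carrier_mat n n"
  shows "hs A (lap A) \<le> (4 * (hs x x + hs y y)) * variance A"
proof -
  have N: "A - mean_part A \<in> carrier_mat n n" by simp
  have "hs A (lap A) = hs (commut y (A - mean_part A)) (commut y (A - mean_part A))
      + hs (commut x (A - mean_part A)) (commut x (A - mean_part A))"
    using A by (simp add: hs_nc_laplacian[OF x y] commut_mean_part x_carrier y_carrier)
  also have "\<dots> \<le> 4 * hs y y * variance A + 4 * hs x x * variance A"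
    unfolding variance_def by (intro add_mono hs_commut_self_le[OF y_carrier N]
        hs_commut_self_le[OF x_carrier N])
  finally show ?thesis by (simp add: algebra_simps)
qed

lemma flow_variance_deriv:
  assumes fl: "flow f I t0 c" and t: "t \<ge> t0"
  shows "((\<lambda>s. variance (c s)) has_real_derivative - 2 * hs (c t) (lap (fcalc n f (c t))))
      (at t within {t0..})"
proof -
  \<comment> \<open>The trace is conserved, so the centre may be frozen at time
    \<open>t0\<close>.\<close>
  let ?N = "\<lambda>s. c s - mean_part (c t0)"
  note c = flow_fcalc_carrier[OF fl t] and ct = flow_carrier[OF fl t]
  have "((\<lambda>s. hs (?N s) (?N s)) has_real_derivative 2 * hs (?N t) (- lap (fcalc n f (c
      t)))) (at t within {t0..})"
    by (rule hs_self_has_derivative[where n = n])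
      (use t c flow_deriv[OF fl t] in \<open>auto intro!: mat_deriv_minus_const\<close>)
  moreover have "hs (?N t) (- lap (fcalc n f (c t))) = - hs (c t) (lap (fcalc n f (c t)))"
    using c ct by (simp add: hs_uminus_right[of _ n] hs_lap_mean_part)
  ultimately have "((\<lambda>s. hs (?N s) (?N s)) has_real_derivative - 2 * hs (c t) (lap (fcalc n
      f (c t)))) (at t within {t0..})"
    by simp
  moreover have "variance (c s) = hs (?N s) (?N s)" if "s \<in> {t0..}" for s
    using flow_mtrace[OF fl, of s] that by (simp add: variance_def mean_part_def)
  ultimately show ?thesis
    unfolding has_real_derivative_iff_has_vector_derivative
    using has_vector_derivative_transform[of t "{t0..}" "\<lambda>s. variance (c s)"] t by auto
qed

subsection \<open>The logarithmic flow\<close>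

lemma fcalc_id_spec_in:
  assumes "spec_in n I A"
  shows "fcalc n (\<lambda>s. s) A = A"
  using assms fcalc_id unfolding spec_in_def by blast

text \<open>In the rate, \<open>k\<close> comes from the gap, \<open>M\<close> from the smallest
  slope of \<open>ln\<close> on the spectrum, and \<open>2\<close> from differentiating a
  square.\<close>

lemma ln_flow_variance_decay:
  assumes fl: "flow ln {e..M} t0 c" and e: "e > 0" and M: "M > 0" and k: "k > 0" and t: "t \<ge> t0"
    and gap: "\<And>a. a \<in> carrier_mat n n \<Longrightarrow> variance a \<le> k * hs a (lap a)"
  shows "variance (c t) \<le> variance (c t0) * exp ((- 2 / (k * M)) * (t - t0))"
proof (rule gronwall_le[OF flow_variance_deriv[OF fl]])
  fix r assume r: "r \<ge> t0"
  note s = flow_spec[OF fl r]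
  have "1 * hs (fcalc n (\<lambda>s. s) (c r)) (lap (fcalc n (\<lambda>s. s) (c r)))
      \<le> M * hs (fcalc n (\<lambda>s. s) (c r)) (lap (fcalc n ln (c r)))"
    by (rule hs_lap_mono[OF s]) (use ln_dissipation_lower e in auto)
  then have "hs (c r) (lap (c r)) \<le> M * hs (c r) (lap (fcalc n ln (c r)))"
    unfolding fcalc_id_spec_in[OF s] by simp
  then have "k * hs (c r) (lap (c r)) \<le> k * (M * hs (c r) (lap (fcalc n ln (c r))))"
    using k by (intro mult_left_mono) auto
  then have "variance (c r) \<le> k * M * hs (c r) (lap (fcalc n ln (c r)))"
    using gap[OF flow_carrier[OF fl r]] by simp
  then show "- 2 * hs (c r) (lap (fcalc n ln (c r))) \<le> - 2 / (k * M) * variance (c r)"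
    using k M by (simp add: field_simps)
qed (use t in auto)

text \<open>Backward uniqueness of the constant solutions.\<close>
lemma ln_flow_variance_lower:
  assumes fl: "flow ln {e..M} t0 c" and e: "e > 0" and t: "t \<ge> t0"
  shows "variance (c t0) * exp ((- (8 * (hs x x + hs y y)) / e) * (t - t0)) \<le> variance (c t)"
proof (rule gronwall_ge[OF flow_variance_deriv[OF fl]])
  fix r assume r: "r \<ge> t0"
  note s = flow_spec[OF fl r]
  have "e * hs (fcalc n (\<lambda>s. s) (c r)) (lap (fcalc n ln (c r)))
      \<le> 1 * hs (fcalc n (\<lambda>s. s) (c r)) (lap (fcalc n (\<lambda>s. s) (c r)))"
    by (rule hs_lap_mono[OF s]) (use ln_dissipation_upper e in auto)
  then have "e * hs (c r) (lap (fcalc n ln (c r))) \<le> hs (c r) (lap (c r))"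
    unfolding fcalc_id_spec_in[OF s] by simp
  then have "e * hs (c r) (lap (fcalc n ln (c r))) \<le> (4 * (hs x x + hs y y)) * variance (c r)"
    using hs_lap_le_variance[OF flow_carrier[OF fl r]] by linarith
  then show "- (8 * (hs x x + hs y y)) / e * variance (c r) \<le> - 2 * hs (c r) (lap (fcalc n ln (c r)))"
    using e by (simp add: field_simps)
qed (use t in auto)

text \<open>Gronwall for the squared distance. On \<open>{e..}\<close> the logarithm has Lipschitz
  constant \<open>1 / e\<close>, and Young's inequality splits the pairing of the difference with
  its velocity.\<close>

lemma ln_flow_unique:
  assumes fl: "flow ln {e..} t0 c" and fl': "flow ln {e..} t0 c'" and e: "e > 0"
      and init: "c t0 = c' t0" and t: "t \<ge> t0"
  shows "c t = c' t"
proof -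
  let ?P = "\<lambda>s. c s - c' s" and ?Q = "\<lambda>s. fcalc n ln (c s) - fcalc n ln (c' s)"
  define B where "B = 32 * ((hs x x)\<^sup>2 + (hs y y)\<^sup>2)"
  have d: "((\<lambda>s. hs (?P s) (?P s)) has_real_derivative 2 * hs (?P r) (- lap (fcalc n ln (c
      r)) - (- lap (fcalc n ln (c' r))))) (at r within {t0..})"
    if r: "r \<ge> t0" for r
    by (rule hs_self_has_derivative[where n = n])
      (use r flow_carrier[OF fl] flow_carrier[OF fl'] flow_fcalc_carrier[OF fl] flow_fcalc_carrier[OF fl']
         flow_deriv[OF fl] flow_deriv[OF fl'] in \<open>auto intro!: mat_deriv_minus\<close>)
  have le: "2 * hs (?P r) (- lap (fcalc n ln (c r)) - (- lap (fcalc n ln (c' r))))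
      \<le> (1 + B * (1 / e)\<^sup>2) * hs (?P r) (?P r)"
    if r: "r \<ge> t0" for r
  proof -
    note [simp] = flow_carrier[OF fl r] flow_carrier[OF fl' r] flow_fcalc_carrier[OF fl r]
        flow_fcalc_carrier[OF fl' r]
    have eq: "- lap (fcalc n ln (c r)) - (- lap (fcalc n ln (c' r))) = - lap (?Q r)"
      by (simp add: nc_laplacian_minus[OF x_carrier y_carrier] mat_uminus_diff[of _ n])
    obtain U a where a: "has_spectral n (c r) U a" "\<forall>i<n. a i \<in> {e..}"
        using flow_spec[OF fl r] unfolding spec_in_def by blast
    obtain V b where b: "has_spectral n (c' r) V b" "\<forall>i<n. b i \<in> {e..}"
        using flow_spec[OF fl' r] unfolding spec_in_def by blast
    have Q: "hs (?Q r) (?Q r) \<le> (1 / e)\<^sup>2 * hs (?P r) (?P r)"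
      by (rule fcalc_Lipschitz[OF a(1) b(1)]) (use a(2) b(2) ln_Lipschitz[OF e] in auto)
    have "2 * hs (?P r) (- lap (?Q r)) \<le> hs (?P r) (?P r) + hs (lap (?Q r)) (lap (?Q r))"
      using hs_Young[of "?P r" n "lap (?Q r)"] by (simp add: hs_uminus_right[of _ n])
    also have "hs (lap (?Q r)) (lap (?Q r)) \<le> B * hs (?Q r) (?Q r)"
      unfolding B_def by (rule nc_laplacian_bounded[OF x_carrier y_carrier]) simp
    also have "\<dots> \<le> B * ((1 / e)\<^sup>2 * hs (?P r) (?P r))"
      by (rule mult_left_mono[OF Q]) (simp add: B_def)
    finally show ?thesis unfolding eq by (simp add: algebra_simps)
  qed
  have "hs (?P t) (?P t) \<le> hs (?P t0) (?P t0) * exp ((1 + B * (1 / e)\<^sup>2) * (t - t0))"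
    by (rule gronwall_le[OF d le t]) auto
  also have "hs (?P t0) (?P t0) = 0"
    unfolding init using flow_carrier[OF fl', of t0] by (simp add: hs_self_sum[of _ n])
  finally have "?P t = 0\<^sub>m n n"
    using flow_carrier[OF fl t] flow_carrier[OF fl' t] by (intro hs_self_eq_0) auto
  show ?thesis
  proof (rule eq_matI)
    fix i j assume ij: "i < dim_row (c' t)" "j < dim_col (c' t)"
    then have "?P t $$ (i,j) = c t $$ (i,j) - c' t $$ (i,j)" by simp
    then show "c t $$ (i,j) = c' t $$ (i,j)"
      unfolding \<open>?P t = 0\<^sub>m n n\<close> using ij carrier_matD[OF flow_carrier[OF fl' t]] by simp
  qed (use carrier_matD[OF flow_carrier[OF fl t]] carrier_matD[OF flow_carrier[OF fl' t]] in auto)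
qed

text \<open>Below \<open>e\<close> the logarithm is replaced by a constant, which makes the vector field globally
  Lipschitz; by the minimum principle the solution never notices.\<close>
lemma ln_flow_exists:
  assumes c0: "spec_in n {e..} c0" and e: "e > 0"
  shows "\<exists>c. c t0 = c0 \<and> flow ln {e..} t0 c"
proof -
  define f where "f s = ln (max e s)" for s
  define B where "B = 32 * ((hs x x)\<^sup>2 + (hs y y)\<^sup>2)"
  have B: "B \<ge> 0" unfolding B_def by simp
  have fl: "\<bar>f a - f b\<bar> \<le> 1 / e * \<bar>a - b\<bar>" for a b
  proof -
    have "\<bar>f a - f b\<bar> \<le> \<bar>max e a - max e b\<bar> / e" unfolding f_def
        by (rule ln_Lipschitz[OF e]) auto
    also have "\<dots> \<le> \<bar>a - b\<bar> / e" using e by (intro divide_right_mono) auto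
    finally show ?thesis by simp
  qed
  have "\<exists>c. c t0 = c0 \<and> (\<forall>t\<ge>t0. hermitian_mat n (c t)) \<and>
      (\<forall>t\<ge>t0. \<forall>i<n. \<forall>j<n.
     ((\<lambda>s. c s $$ (i,j)) has_vector_derivative (- lap (fcalc n f (c t))) $$ (i,j))
         (at t within {t0..}))"
  \<comment> \<open>\<open>B\<close> bounds the squared norm of the Laplacian, and
    \<open>1 / e\<close> is the Lipschitz constant of the truncated logarithm.\<close>
  proof (rule hermitian_ode_global[where L = "sqrt B / e"])
    fix A assume A: "hermitian_mat n A"
    have h: "hermitian_mat n (lap (fcalc n f A))"
      by (rule nc_laplacian_hermitian[OF x y fcalc_hermitian[OF A]])
    then show "hermitian_mat n (- lap (fcalc n f A))"
      unfolding hermitian_mat_def by (simp add: ctrans_uminus)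
  next
    fix A A' assume A: "hermitian_mat n A" and A': "hermitian_mat n A'"
    note [simp] = herm_fun_calc_carrier[OF A] herm_fun_calc_carrier[OF A']
    let ?Q = "fcalc n f A - fcalc n f A'"
    obtain U a where a: "has_spectral n A U a" using hermitian_spectralE[OF A] .
    obtain V b where b: "has_spectral n A' V b" using hermitian_spectralE[OF A'] .
    have "hs ?Q ?Q \<le> (1 / e)\<^sup>2 * hs (A - A') (A - A')"
      by (rule fcalc_Lipschitz[OF a b fl])
    then have "B * hs ?Q ?Q \<le> B * ((1 / e)\<^sup>2 * hs (A - A') (A - A'))" using B
        by (intro mult_left_mono)
    moreover have "hs (lap ?Q) (lap ?Q) \<le> B * hs ?Q ?Q"
      unfolding B_def by (rule nc_laplacian_bounded[OF x_carrier y_carrier]) simp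
    moreover have "- lap (fcalc n f A) - (- lap (fcalc n f A')) = - lap ?Q"
      by (simp add: nc_laplacian_minus[OF x_carrier y_carrier] mat_uminus_diff[of _ n])
    ultimately show "hs (- lap (fcalc n f A) - (- lap (fcalc n f A'))) (- lap (fcalc n f A) - (-
        lap (fcalc n f A')))
      \<le> (sqrt B / e)\<^sup>2 * hs (A - A') (A - A')"
      using B by (simp add: hs_uminus_self[of _ n] power_divide)
  qed (rule spec_in_hermitian[OF c0])
  then obtain c where c: "c t0 = c0" "\<And>t. t \<ge> t0 \<Longrightarrow> hermitian_mat n (c t)"
    "\<And>t. t \<ge> t0 \<Longrightarrow> mat_deriv n c (- lap (fcalc n f (c t))) t {t0..}"
        unfolding mat_deriv_def by blast
  \<comment> \<open>Positivity is not known yet, but the truncation is monotone on all reals, so the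
    minimum principle already applies.\<close>
  then have "flow f UNIV t0 c" unfolding flow_def using spec_in_UNIV by auto
  then have spec: "spec_in n {e..} (c t)" if "t \<ge> t0" for t
  proof (rule flow_spec_ge)
    show "mono f" unfolding f_def using e by (intro monoI) (auto simp: max_def)
  qed (use that c0 c(1) in auto)
  have "fcalc n f (c t) = fcalc n ln (c t)" if t: "t \<ge> t0" for t
  proof -
    obtain U d where "has_spectral n (c t) U d" "\<forall>i<n. d i \<in> {e..}"
        using spec[OF t] unfolding spec_in_def by blast
    then show ?thesis by (intro fcalc_cong) (auto simp: f_def max_def)
  qed
  then have "flow ln {e..} t0 c" unfolding flow_def using spec c(3) by metis
  then show ?thesis using c(1) by blast
qed

section \<open>Growth of the determinant\<close>

lemma det_exp_trf:
  assumes "spec_in n {0<..} A"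
  shows "Re (det A) = exp (trf n ln A)"
proof -
  obtain U d where s: "has_spectral n A U d" and d: "\<forall>i<n. d i \<in> {0<..}"
      using assms unfolding spec_in_def by blast
  have "(\<Prod>i<n. d i) = exp (\<Sum>i<n. ln (d i))"
    unfolding exp_sum[OF finite_lessThan] using d by (intro prod.cong) auto
  then show ?thesis unfolding det_spectral[OF s] trf_spectral[OF s] by simp
qed

lemma ln_flow_det_strict_mono:
  assumes fl: "flow ln {e..M} t0 c" and e: "e > 0" and M: "M > 0" and k: "k > 0"
    and gap: "\<And>a. a \<in> carrier_mat n n \<Longrightarrow> variance a \<le> k * hs a (lap a)"
    and ne: "variance (c t0) > 0" and st: "t0 \<le> s" "s < t"
  shows "Re (det (c s)) < Re (det (c t))"
proof -
  have d: "((\<lambda>s. trf n ln (c s)) has_real_derivative - hs (fcalc n (\<lambda>s. 1 / s) (c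
      r)) (lap (fcalc n ln (c r)))) (at r within {t0..})"
    if "r \<ge> t0" for r
    by (rule flow_trf_deriv[OF fl that, of ln "\<lambda>s. 1 / s" "1 / e\<^sup>2"]) (use
        ln_first_order[OF e] in auto)
  have "0 < - hs (fcalc n (\<lambda>s. 1 / s) (c r)) (lap (fcalc n ln (c r)))" if r: "r \<ge> t0" for r
  proof -
    note s = flow_spec[OF fl r]
    have "0 < variance (c t0) * exp ((- (8 * (hs x x + hs y y)) / e) * (r - t0))" using ne by simp
    also have "\<dots> \<le> variance (c r)" by (rule ln_flow_variance_lower[OF fl e r])
    also have "\<dots> \<le> k * hs (c r) (lap (c r))" by (rule gap[OF flow_carrier[OF fl r]])
    finally have pos: "0 < hs (c r) (lap (c r))" using k by (simp add: zero_less_mult_iff)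
    \<comment> \<open>One factor \<open>M\<close> bounds the slopes of \<open>ln\<close> from below;
      the other two come from \<open>1 / a - 1 / b = - (a - b) / (a * b)\<close> with
      \<open>a * b \<le> M * M\<close>. The sign is negative because the reciprocal
      decreases.\<close>
    have "M ^ 3 * hs (fcalc n (\<lambda>s. 1 / s) (c r)) (lap (fcalc n ln (c r)))
        \<le> (- 1) * hs (fcalc n (\<lambda>s. s) (c r)) (lap (fcalc n (\<lambda>s. s) (c r)))"
    proof (rule hs_lap_mono[OF s])
      fix a b assume "a \<in> {e..M}" "b \<in> {e..M}"
      then have ab: "0 < a" "0 < b" "a \<le> M" "b \<le> M" using e by auto
      have 1: "(a - b) * (a - b) \<le> M * ((a - b) * (ln a - ln b))" by (rule ln_dissipation_lower[OF ab])
      then have p: "0 \<le> M * ((a - b) * (ln a - ln b))" by (meson order_trans zero_le_square)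
      then have q: "0 \<le> (a - b) * (ln a - ln b)" using M by (simp add: zero_le_mult_iff)
      have "a * b \<le> M * M" using ab by (intro mult_mono) auto
      then have "1 \<le> M * M / (a * b)" using ab by simp
      then have "M * ((a - b) * (ln a - ln b)) * 1 \<le> M * ((a - b) * (ln a - ln b)) * (M * M / (a * b))"
        using p by (intro mult_left_mono) auto
      also have "\<dots> = - (M ^ 3 * ((1 / a - 1 / b) * (ln a - ln b)))"
        using ab by (simp add: field_simps power3_eq_cube)
      finally show "M ^ 3 * ((1 / a - 1 / b) * (ln a - ln b))
          \<le> - 1 * ((a - b) * (a - b))" using 1 by linarith
    qed
    then have "M ^ 3 * hs (fcalc n (\<lambda>s. 1 / s) (c r)) (lap (fcalc n ln (c r))) < 0"
      unfolding fcalc_id_spec_in[OF s] using pos by linarith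
    then show ?thesis using M by (simp add: mult_less_0_iff)
  qed
  then have "trf n ln (c s) < trf n ln (c t)" using half_line_strict_mono[OF d] st by blast
  moreover have "spec_in n {0<..} (c r)" if "r \<ge> t0" for r
    by (rule spec_in_mono[OF flow_spec[OF fl that]]) (use e in auto)
  ultimately show ?thesis using det_exp_trf st by simp
qed

section \<open>From the logarithmic flow to the Ricci flow\<close>

lemma ricci_solution_iff_flow:
  "ricci_solution n x y t0 c0 c \<longleftrightarrow> c t0 = c0 \<and> flow ln {0<..} t0 c"
  unfolding ricci_solution_def flow_def mat_deriv_def mat_log_def strictly_pos_iff_spec_in by blast

lemma flow_mono: "flow f I t0 c \<Longrightarrow> I \<subseteq> J \<Longrightarrow> flow f J t0 c"
  unfolding flow_def using spec_in_mono by blast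

lemma spec_in_trace_bound:
  assumes A: "spec_in n {e..} A" and e: "e > 0"
  shows "spec_in n {e..Re (mtrace A)} A"
proof -
  obtain U d where s: "has_spectral n A U d" and d: "\<forall>i<n. d i \<in> {e..}"
      using A unfolding spec_in_def by blast
  have "d i \<le> (\<Sum>i<n. d i)" if "i < n" for i
    using that d e by (intro member_le_sum) (auto intro: order_trans[of 0 e])
  then show ?thesis using d unfolding spec_in_spectral[OF s] mtrace_spectral[OF s] by auto
qed

lemma spec_in_pos_lower:
  assumes A: "spec_in n {0<..} A"
  shows "\<exists>e>0. spec_in n {e..} A"
proof -
  obtain U d where s: "has_spectral n A U d" and d: "\<forall>i<n. 0 < d i"
      using A unfolding spec_in_def by auto
  \<comment> \<open>The inserted \<open>1\<close> keeps the set nonempty when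
    \<open>n = 0\<close>.\<close>
  define e where "e = Min (insert 1 (d ` {..<n}))"
  have "e > 0" unfolding e_def using d by (subst Min_gr_iff) auto
  moreover have "spec_in n {e..} A" unfolding spec_in_spectral[OF s] e_def by auto
  ultimately show ?thesis by blast
qed

lemma variance_eq_0:
  assumes A: "A \<in> carrier_mat n n"
  shows "variance A = 0 \<longleftrightarrow> A = mean_part A"
proof
  assume "variance A = 0"
  then have z: "A - mean_part A = 0\<^sub>m n n" unfolding variance_def by (intro hs_self_eq_0) auto
  show "A = mean_part A"
  proof (rule eq_matI)
    fix i j assume ij: "i < dim_row (mean_part A)" "j < dim_col (mean_part A)"
    then have "(A - mean_part A) $$ (i,j) = A $$ (i,j) - mean_part A $$ (i,j)" by simp
    then show "A $$ (i,j) = mean_part A $$ (i,j)"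
      unfolding z using ij carrier_matD[OF mean_part_carrier] by simp
  qed (use A carrier_matD[OF mean_part_carrier] in auto)
next
  assume eq: "A = mean_part A"
  have "A - mean_part A = 0\<^sub>m n n" using A by (subst eq[symmetric]) auto
  then show "variance A = 0" unfolding variance_def by (simp add: hs_self_sum[of _ n])
qed

theorem ricci_flow:
  assumes n: "n > 0" and k: "k > 0"
      and gap: "\<And>a. a \<in> carrier_mat n n \<Longrightarrow> variance a \<le> k * hs a (lap a)"
    and c0: "strictly_pos_mat n c0"
  shows "\<exists>c. ricci_solution n x y t0 c0 c
     \<and> (\<forall>c'. ricci_solution n x y t0 c0 c' \<longrightarrow> (\<forall>t\<ge>t0. c' t = c t))
     \<and> (\<forall>t\<ge>t0. mtrace (c t) = mtrace c0)
     \<and> (\<forall>i<n. \<forall>j<n. ((\<lambda>t. c t $$ (i,j)) \<longlongrightarrow>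
         mean_part c0 $$ (i,j)) at_top)
     \<and> (c0 \<noteq> mean_part c0 \<longrightarrow>
          (\<forall>s t. t0 \<le> s \<longrightarrow> s < t \<longrightarrow> Re (det (c s)) < Re (det (c t))))
     \<and> (c0 = mean_part c0 \<longrightarrow> (\<forall>t\<ge>t0. c t = c0))"
proof -
  obtain e where e: "e > 0" and c0e: "spec_in n {e..} c0"
    using spec_in_pos_lower c0 unfolding strictly_pos_iff_spec_in by blast
  obtain c where c: "c t0 = c0" and fe: "flow ln {e..} t0 c" using ln_flow_exists[OF c0e e] by blast
  note tr = flow_mtrace[OF fe, unfolded c]
  define M where "M = Re (mtrace c0)"
  have fl: "flow ln {e..M} t0 c"
    unfolding flow_def
  proof (intro allI impI conjI)
    fix t assume t: "t0 \<le> t"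
    show "spec_in n {e..M} (c t)" using spec_in_trace_bound[OF flow_spec[OF fe t] e] unfolding tr[OF t] M_def .
    show "mat_deriv n c (- lap (fcalc n ln (c t))) t {t0..}" by (rule flow_deriv[OF fe t])
  qed
  have M: "M > 0"
  proof -
    obtain U d where "has_spectral n c0 U d" "\<forall>i<n. d i \<in> {e..M}"
      using flow_spec[OF fl, of t0] unfolding c spec_in_def by auto
    \<comment> \<open>A single eigenvalue, available as \<open>n > 0\<close>, forces
      \<open>e \<le> M\<close>.\<close>
    then have "d 0 \<in> {e..M}" using n by blast
    then show ?thesis using e by simp
  qed
  have sol: "ricci_solution n x y t0 c0 c"
  proof -
    have "{e..} \<subseteq> {0<..}" using e by auto
    then show ?thesis unfolding ricci_solution_iff_flow using c flow_mono[OF fe] by blast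
  qed
  have uniq: "c' t = c t" if c': "ricci_solution n x y t0 c0 c'" and t: "t \<ge> t0" for c' t
  proof -
    have c'0: "c' t0 = c0" and f': "flow ln {0<..} t0 c'" using c' unfolding ricci_solution_iff_flow by auto
    have mono: "mono_on {0<..} (ln :: real \<Rightarrow> real)" by (intro mono_onI) auto
    \<comment> \<open>The competitor inherits the lower bound \<open>e\<close> from
      \<open>c0\<close>, so both solutions live where the logarithm is Lipschitz.\<close>
    have "spec_in n {e..} (c' s)" if "s \<ge> t0" for s
      using flow_spec_ge[OF f' mono _ that] c0e unfolding c'0 by blast
    then have "flow ln {e..} t0 c'" using f' unfolding flow_def by blast
    from ln_flow_unique[OF this fe e _ t] show ?thesis using c c'0 by simp
  qed
  have mean: "mean_part (c t) = mean_part c0" if "t \<ge> t0" for t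
    unfolding mean_part_def tr[OF that] ..
  define w where "w t = variance (c t0) * exp ((- 2 / (k * M)) * (t - t0))" for t
  have decay: "variance (c t) \<le> w t" if "t \<ge> t0" for t
    unfolding w_def by (rule ln_flow_variance_decay[OF fl e M k that gap])
  have w: "(w \<longlongrightarrow> 0) at_top"
  proof -
    define r where "r = 2 / (k * M)"
    have r: "r > 0" unfolding r_def using k M by simp
    have "filterlim (\<lambda>t. r * (t - t0)) at_top at_top"
      using r by (intro filterlim_tendsto_pos_mult_at_top[OF tendsto_const])
        (auto intro: filterlim_tendsto_add_at_top[OF tendsto_const filterlim_ident, of "- t0", simplified])
    then have "((\<lambda>t. exp (- (r * (t - t0)))) \<longlongrightarrow> 0) at_top"
      by (intro filterlim_compose[OF exp_at_bot] filterlim_compose[OF filterlim_uminus_at_bot_at_top])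
    then have "((\<lambda>t. variance (c t0) * exp (- (r * (t - t0)))) \<longlongrightarrow>
        variance (c t0) * 0) at_top"
      by (intro tendsto_mult tendsto_const)
    then show ?thesis unfolding w_def r_def by simp
  qed
  have lim: "((\<lambda>t. c t $$ (i,j)) \<longlongrightarrow> mean_part c0 $$ (i,j)) at_top"
      if ij: "i < n" "j < n" for i j
  proof -
    have "((\<lambda>t. c t $$ (i,j) - mean_part c0 $$ (i,j)) \<longlongrightarrow> 0) at_top"
    proof (rule Lim_null_comparison)
      show "((\<lambda>t. sqrt (w t)) \<longlongrightarrow> 0) at_top" using tendsto_real_sqrt[OF w] by simp
      show "\<forall>\<^sub>F t in at_top. norm (c t $$ (i,j) - mean_part c0 $$ (i,j)) \<le> sqrt (w t)"
      proof (rule eventually_mono[OF eventually_ge_at_top[of t0]])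
        fix t assume t: "t0 \<le> t"
        have N: "c t - mean_part c0 \<in> carrier_mat n n" by simp
        have "(cmod ((c t - mean_part c0) $$ (i,j)))\<^sup>2 \<le> variance (c t)"
          using entry_le_hs[OF N ij] unfolding variance_def mean[OF t] .
        also have "\<dots> \<le> w t" by (rule decay[OF t])
        finally show "norm (c t $$ (i,j) - mean_part c0 $$ (i,j)) \<le> sqrt (w t)"
          using ij carrier_matD[OF mean_part_carrier[of c0]] by (simp add: real_le_rsqrt)
      qed
    qed
    then show ?thesis by (rule LIM_zero_cancel)
  qed
  have c0c: "c0 \<in> carrier_mat n n" using flow_carrier[OF fe, of t0] c by simp
  have det: "Re (det (c s)) < Re (det (c t))"
      if ne: "c0 \<noteq> mean_part c0" and st: "t0 \<le> s" "s < t" for s t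
  proof (rule ln_flow_det_strict_mono[OF fl e M k gap _ st])
    show "variance (c t0) > 0" using ne variance_eq_0[OF c0c] variance_nonneg[of c0] unfolding c by linarith
  qed
  have const: "c t = c0" if eq: "c0 = mean_part c0" and t: "t \<ge> t0" for t
  proof -
    \<comment> \<open>The decay bound is proportional to the initial variance, so a scalar start
      stays scalar, with the same trace.\<close>
    have "w t = 0" using eq variance_eq_0[OF c0c] unfolding w_def c by simp
    then have "variance (c t) = 0" using decay[OF t] variance_nonneg[of "c t"] by simp
    then show ?thesis using variance_eq_0[OF flow_carrier[OF fe t]] mean[OF t] eq by simp
  qed
  show ?thesis using sol uniq tr lim det const by blast
qed

end

theorem theorem3p2:
  fixes n m :: nat and x y c0 :: "complex mat" and t0 :: real
  assumes "n \<ge> 2" and "1 \<le> m" and "m \<le> n - 1" and "coprime m n"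
    and "hermitian_mat n x" and "hermitian_mat n y"
    and "u_mat n m = exp_2pii_over n x" and "v_mat n = exp_2pii_over n y"
    and "strictly_pos_mat n c0"
  shows "\<exists>c. ricci_solution n x y t0 c0 c
     \<and> (\<forall>c'. ricci_solution n x y t0 c0 c' \<longrightarrow> (\<forall>t\<ge>t0. c' t = c t))
     \<and> (\<forall>t\<ge>t0. mtrace (c t) = mtrace c0)
     \<and> (\<forall>i<n. \<forall>j<n. ((\<lambda>t. c t $$ (i,j)) \<longlongrightarrow>
            ((mtrace c0 / of_nat n) \<cdot>\<^sub>m 1\<^sub>m n) $$ (i,j)) at_top)
     \<and> (c0 \<noteq> (mtrace c0 / of_nat n) \<cdot>\<^sub>m 1\<^sub>m n \<longrightarrow>
          (\<forall>s t. t0 \<le> s \<longrightarrow> s < t \<longrightarrow> Re (det (c s)) < Re (det (c t))))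
     \<and> (c0 = (mtrace c0 / of_nat n) \<cdot>\<^sub>m 1\<^sub>m n \<longrightarrow>
         (\<forall>t\<ge>t0. c t = c0))"
proof -
  interpret hermitian_pair n x y using assms(5,6) by unfold_locales
  obtain k where "k > 0" and "\<And>a. a \<in> carrier_mat n n \<Longrightarrow>
      variance a \<le> k * hs a (lap a)"
    using laplacian_gap[OF assms(1,4-8)] unfolding variance_def mean_part_def by blast
  with assms(1,9) show ?thesis by (intro ricci_flow[unfolded mean_part_def]) auto
qed

end
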